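(* For every $\varepsilon\in(0,1)$ there is $n_0$ such that for all integers $n\ge n_0$ the following holds. Let $a_1,\ldots,a_k$ be a sequence of positive integers such that $\sum_{i=1}^{k} a_i<(1-\varepsilon)n$ and either (i) $a_i\le n^{1-\varepsilon}$ for all $i\in\{1,\ldots,k\}$, or (ii) $a_i\ge n^{\varepsilon}$ for all $i\in\{1,\ldots,k\}$. Then the sequence $a_1,\ldots,a_k$ is $(\varepsilon,n)$-happy.
   Context: $K_{2n}$ denotes the complete graph on $2n$ vertices. Matchings are regarded as sets of edges, and "disjoint perfect matchings" means pairwise edge-disjoint perfect matchings. Definition. A sequence of integers $a_1,\ldots,a_k$ is $(\varepsilon,n)$-happy if there is an integer $\ell\in[k,(1+\varepsilon)k]$ such that for any $\ell$ disjoint perfect matchings of $K_{2n}$ there are $k$ (distinct) ones among them, which can be labelled $M_1,\ldots,M_k$, and a matching $M$ in $K_{2n}$ such that $|M\cap M_i|\ge a_i$ for all $i\in\{1,\ldots,k\}$. *)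

theory Defs
  imports Complex_Main "HOL-Library.Disjoint_Sets"
begin

text \<open>Edges are two-element sets of vertices; the complete graph on \<open>m\<close> vertices has vertex set
  \<open>{..<m}\<close>, and graphs on that vertex set are identified with their edge sets.\<close>

definition complete_edges :: "nat \<Rightarrow> nat set set" where
  "complete_edges m = {e. e \<subseteq> {..<m} \<and> card e = 2}"

definition is_matching :: "nat \<Rightarrow> nat set set \<Rightarrow> bool" where
  "is_matching m M \<longleftrightarrow> M \<subseteq> complete_edges m \<and> disjoint M"

definition is_perfect_matching :: "nat \<Rightarrow> nat set set \<Rightarrow> bool" where
  "is_perfect_matching m M \<longleftrightarrow> is_matching m M \<and> \<Union>M = {..<m}"

text \<open>The sequence \<open>a\<^sub>1, \<dots>, a\<^sub>k\<close> is given by its length \<open>k\<close> and the values of \<open>a\<close> on \<open>{1..k}\<close>.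
  Since \<open>l \<ge> k\<close>, the integer \<open>l\<close> can be taken to be a natural number. The two uses of
  \<^const>\<open>disjoint\<close> are at different levels: for a matching it says that its edges share no vertex,
  for the family \<open>P\<close> that its matchings share no edge. The injection \<open>L\<close> both selects and labels
  the \<open>k\<close> matchings.\<close>

definition happy :: "real \<Rightarrow> nat \<Rightarrow> nat \<Rightarrow> (nat \<Rightarrow> int) \<Rightarrow> bool" where
  "happy \<epsilon> n k a \<longleftrightarrow>
    (\<exists>l::nat. k \<le> l \<and> real l \<le> (1 + \<epsilon>) * real k \<and>
      (\<forall>P. finite P \<and> card P = l \<and> (\<forall>N\<in>P. is_perfect_matching (2 * n) N) \<and> disjoint P \<longrightarrow>
        (\<exists>L M. inj_on L {1..k} \<and> L ` {1..k} \<subseteq> P \<and> is_matching (2 * n) M \<and>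
          (\<forall>i\<in>{1..k}. int (card (M \<inter> L i)) \<ge> a i))))"

end

theory Submission
  imports Defs
begin

text \<open>
  The perfect matchings are colours, and the number \<open>a\<^sub>i\<close> is the demand of the \<open>i\<close>-th colour. Let a demand
  be small if it is below a constant depending on \<open>\<epsilon>\<close> only. Three facts, none of them
  probabilistic, carry the proof.

  Large demands can be met by local optimisation (\<open>balanced_matching\<close>). A matching \<open>M\<close> with fewer than
  \<open>(1 - \<epsilon>/2) n\<close> edges has, for every colour, an augmenting path of bounded length with respect to that
  colour, since there are at least \<open>\<epsilon>n/2\<close> disjoint ones. Augmenting along the colour that
  is worst off gains one edge more than it costs all other colours together. With a quadratic
  penalty for deficits this is an improvement, as long as the deficit is a fixed proportion of the demand
  and the demands are so large that second-order effects are negligible. So, after all large demands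
  have been increased by a small factor, an optimal matching meets the original ones.

  Small demands need a finer argument (\<open>matching_missing_few_slots\<close>). Split each colour into as many
  slots as it demands, and take a maximum matching of coloured edges using each slot at most once.
  Let \<open>x\<close> be a vertex with many edges to uncovered vertices in unused slots. Moving \<open>x\<close> from its old
  edge to one of these uncovers the other vertex of the old edge and frees its slot.
  Maximality forbids such an \<open>x\<close> at both ends of an edge, and forbids edges between two vertices that can
  be uncovered, in a slot that can be freed. Counting then shows that the set of these vertices grows by a
  fixed proportion of \<open>n\<close> in every round, which is impossible for long, unless the number of
  unused slots is at most a constant times the largest number of slots in which two vertices are joined. That number is at most the largest demand,
  hence of the order of \<open>n powr (1 - \<epsilon>)\<close> at most under hypothesis (i).

  If the small demands together amount to little, they are met greedily and the large ones by
  optimisation on the remaining vertices (\<open>matching_few_small_demands\<close>); this takes exactly \<open>k\<close> colours and covers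
  hypothesis (ii), under which no demand is small. Otherwise \<open>k\<close> is proportional to \<open>n\<close>, so there may be
  about \<open>\<epsilon>k\<close> spare colours, for large \<open>n\<close> far more than the number of colours spoilt by the slot
  argument and the optimisation, and the spare colours take over the labels of the spoilt ones
  (\<open>matching_with_spare_colours\<close>).
\<close>

section \<open>Augmenting one matching along another\<close>

lemma disjoint_exchange:
  assumes "disjoint M" "disjoint A" "\<forall>e\<in>M - D. e \<inter> \<Union>A = {}"
  shows "disjoint ((M - D) \<union> A)"
proof (rule pairwiseI)
  fix e f assume "e \<in> M - D \<union> A" "f \<in> M - D \<union> A" "e \<noteq> f"
  then consider "e \<in> M" "f \<in> M" | "e \<in> A" "f \<in> A" | "e \<in> M - D" "f \<in> A" | "e \<in> A" "f \<in> M - D" by blast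
  then show "disjnt e f"
  proof cases
    case 1 then show ?thesis using assms(1) \<open>e \<noteq> f\<close> by (simp add: pairwise_def)
  next
    case 2 then show ?thesis using assms(2) \<open>e \<noteq> f\<close> by (simp add: pairwise_def)
  qed (use assms(3) in \<open>auto simp: disjnt_def\<close>)
qed

lemma disjoint_Un:
  assumes "disjoint A" "disjoint B" "\<Union>A \<inter> \<Union>B = {}"
  shows "disjoint (A \<union> B)"
proof (rule pairwiseI)
  fix e f assume "e \<in> A \<union> B" "f \<in> A \<union> B" "e \<noteq> f"
  then consider "e \<in> A" "f \<in> A" | "e \<in> B" "f \<in> B" | "e \<in> A" "f \<in> B" | "e \<in> B" "f \<in> A" by blast
  then show "disjnt e f"
    using assms \<open>e \<noteq> f\<close> by cases (auto simp: pairwise_def disjnt_def)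
qed

lemma card_eq_sum_classes:
  assumes "finite I" "finite M" "disjoint_family_on N I" "M \<subseteq> (\<Union>i\<in>I. N i)"
  shows "card M = (\<Sum>i\<in>I. card (M \<inter> N i))"
proof -
  have "M = (\<Union>i\<in>I. M \<inter> N i)" using assms(4) by auto
  then have "card M = card (\<Union>i\<in>I. M \<inter> N i)" by simp
  also have "\<dots> = (\<Sum>i\<in>I. card (M \<inter> N i))"
    using assms by (intro card_UN_disjoint) (auto simp: disjoint_family_on_def)
  finally show ?thesis .
qed

text \<open>\<open>M - D \<union> A\<close> is again a matching, one edge larger than \<open>M\<close>: this is the exchange along one augmenting
path of \<open>M\<close> and \<open>N\<close>, with the path itself forgotten.\<close>
definition augmentation :: "'a set set \<Rightarrow> 'a set set \<Rightarrow> 'a set set \<Rightarrow> 'a set set \<Rightarrow> bool" where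
  "augmentation M N D A \<longleftrightarrow> D \<subseteq> M \<and> A \<subseteq> N \<and> card A = Suc (card D) \<and> (\<forall>e\<in>M - D. e \<inter> \<Union>A = {})"

text \<open>The union of \<open>M\<close> and \<open>N\<close> consists of paths and cycles, and at least \<open>|N| - |M|\<close> of the paths are
augmenting. An induction on \<open>M\<close> avoids speaking of paths. Without \<open>M\<close>, each edge of \<open>N\<close> is an
augmentation by itself. A new edge \<open>e\<close> of \<open>M\<close> touches at most two of the current augmentations,
because these use disjoint parts of the matching \<open>N\<close>. If it touches two of them, they are glued
together at \<open>e\<close>; if it touches one, that one is thrown away. Either way only one augmentation is
lost.\<close>
lemma disjoint_augmentations:
  fixes M N :: "'a set set"
  assumes "finite M" "finite N" "disjoint M" "disjoint N" "\<forall>e\<in>M. card e = 2"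
  shows "\<exists>(I :: 'a set set) D A. finite I \<and> card N \<le> card I + card M \<and>
    disjoint_family_on D I \<and> disjoint_family_on A I \<and>
    (\<forall>i\<in>I. augmentation M N (D i) (A i))"
  using assms(1,3,5)
proof (induction M rule: finite_induct)
  case empty
  show ?case
    by (rule exI[of _ N], rule exI[of _ "\<lambda>_. {}"], rule exI[of _ "\<lambda>e. {e}"])
      (use assms(2) in \<open>auto simp: disjoint_family_on_def augmentation_def\<close>)
next
  case (insert e M)
  have "disjoint M" "\<forall>e\<in>M. card e = 2"
    using insert.prems pairwise_subset[of disjnt "insert e M" M] by auto
  from insert.IH[OF this] obtain I :: "'a set set" and D A where
    fI: "finite I" and cI: "card N \<le> card I + card M" and
    dD: "disjoint_family_on D I" and dA: "disjoint_family_on A I" and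
    aug: "\<forall>i\<in>I. augmentation M N (D i) (A i)"
    by (elim exE conjE) (rule that)
  have DA: "D i \<subseteq> M \<and> A i \<subseteq> N \<and> card (A i) = Suc (card (D i)) \<and>
      (\<forall>e\<in>M - D i. e \<inter> \<Union>(A i) = {})" if "i \<in> I" for i
    using aug that by (simp add: augmentation_def)
  \<comment> \<open>The sets \<open>A i\<close> cover pairwise disjoint sets of vertices.\<close>
  have unique: "i = j" if ij: "i \<in> I" "j \<in> I" "x \<in> \<Union>(A i)" "x \<in> \<Union>(A j)" for i j x
  proof (rule ccontr)
    assume "i \<noteq> j"
    then have "A i \<inter> A j = {}" using dA ij(1,2) by (auto simp: disjoint_family_on_def)
    moreover obtain a b where "a \<in> A i" "x \<in> a" "b \<in> A j" "x \<in> b" using ij(3,4) by blast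
    moreover have "a \<in> N" "b \<in> N" using DA ij(1,2) \<open>a \<in> A i\<close> \<open>b \<in> A j\<close> by blast+
    ultimately show False using \<open>disjoint N\<close> unfolding pairwise_def disjnt_def by (metis IntI empty_iff)
  qed
  obtain x y where e: "e = {x, y}" using insert.prems by (auto simp: card_2_iff)
  show ?case
  proof (cases "\<exists>i\<in>I. \<exists>j\<in>I. i \<noteq> j \<and> x \<in> \<Union>(A i) \<and> y \<in> \<Union>(A j)")
    case True
    then obtain i j where ij: "i \<in> I" "j \<in> I" "i \<noteq> j" "x \<in> \<Union>(A i)" "y \<in> \<Union>(A j)" by blast
    let ?I = "I - {j}"
    let ?D = "D(i := insert e (D i \<union> D j))"
    let ?A = "A(i := A i \<union> A j)"
    have "card ?I + 1 = card I" using card_Suc_Diff1[OF fI ij(2)] by simp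
    then have c: "card N \<le> card ?I + card (insert e M)" using cI insert.hyps by simp
    have eD: "e \<notin> D i'" if "i' \<in> I" for i' using DA[OF that] insert.hyps by blast
    have d1: "disjoint_family_on ?D ?I"
      using dD ij eD by (auto simp: disjoint_family_on_def)
    have d2: "disjoint_family_on ?A ?I"
      using dA ij by (auto simp: disjoint_family_on_def)
    have fin: "finite (D i)" "finite (D j)" "finite (A i)" "finite (A j)"
      using DA[OF ij(1)] DA[OF ij(2)] insert.hyps assms(2) by (auto intro: finite_subset)
    have cD: "card (insert e (D i \<union> D j)) = Suc (card (D i) + card (D j))"
      using fin eD ij dD by (subst card_insert_disjoint)
        (auto simp: card_Un_disjoint disjoint_family_on_def)
    have cA: "card (A i \<union> A j) = card (A i) + card (A j)"
      using fin ij dA by (auto simp: card_Un_disjoint disjoint_family_on_def)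
    have "augmentation (insert e M) N (?D l) (?A l)" if l: "l \<in> ?I" for l
    proof (cases "l = i")
      case True
      have "augmentation (insert e M) N (insert e (D i \<union> D j)) (A i \<union> A j)"
        unfolding augmentation_def
      proof (intro conjI ballI)
        show "card (A i \<union> A j) = Suc (card (insert e (D i \<union> D j)))"
          using cA cD DA[OF ij(1)] DA[OF ij(2)] by simp
        fix f assume f: "f \<in> insert e M - insert e (D i \<union> D j)"
        then have "f \<inter> \<Union>(A i) = {}" using DA[OF ij(1)] by blast
        moreover have "f \<inter> \<Union>(A j) = {}" using DA[OF ij(2)] f by blast
        ultimately show "f \<inter> \<Union>(A i \<union> A j) = {}" by blast
      qed (use DA[OF ij(1)] DA[OF ij(2)] in auto)
      then show ?thesis using True by simp
    next
      case False
      have "x \<notin> \<Union>(A l)" "y \<notin> \<Union>(A l)" using unique ij l False by blast+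
      then have "e \<inter> \<Union>(A l) = {}" using e by auto
      moreover have "augmentation M N (D l) (A l)" using aug l by simp
      ultimately have "augmentation (insert e M) N (D l) (A l)"
        unfolding augmentation_def by (simp add: subset_insertI2 insert_Diff_if)
      then show ?thesis using False by simp
    qed
    moreover have "finite ?I" using fI by simp
    ultimately show ?thesis using c d1 d2
      by - (rule exI[of _ ?I], rule exI[of _ ?D], rule exI[of _ ?A], blast)
  next
    case False
    let ?J = "{i \<in> I. e \<inter> \<Union>(A i) \<noteq> {}}"
    let ?I = "I - ?J"
    have J: "i = j" if "i \<in> ?J" "j \<in> ?J" for i j
    proof -
      have "e \<inter> \<Union>(A i) \<noteq> {}" "e \<inter> \<Union>(A j) \<noteq> {}" and iI: "i \<in> I" "j \<in> I" using that by auto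
      then obtain p q where p: "p \<in> e" "p \<in> \<Union>(A i)" and q: "q \<in> e" "q \<in> \<Union>(A j)" by blast
      consider "p = q" | "p = x" "q = y" | "p = y" "q = x" using p q e by blast
      then show ?thesis using p q iI False unique by cases (metis)+
    qed
    have "card ?J \<le> 1"
      using J fI by (intro card_le_Suc0_iff_eq[THEN iffD2, simplified One_nat_def[symmetric]]) auto
    moreover have "card ?I + card ?J = card I"
      using fI by (simp add: card_Diff_subset card_mono)
    ultimately have c: "card N \<le> card ?I + card (insert e M)" using cI insert.hyps by simp
    have "augmentation (insert e M) N (D l) (A l)" if l: "l \<in> ?I" for l
    proof -
      have "e \<inter> \<Union>(A l) = {}" using l by simp
      moreover have "augmentation M N (D l) (A l)" using aug l by simp
      ultimately show ?thesis
        unfolding augmentation_def by (simp add: subset_insertI2 insert_Diff_if)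
    qed
    moreover have "disjoint_family_on D ?I" "disjoint_family_on A ?I"
      using dD dA by (simp_all add: disjoint_family_on_def)
    moreover have "finite ?I" using fI by simp
    ultimately show ?thesis using c
      by - (rule exI[of _ ?I], rule exI[of _ D], rule exI[of _ A], blast)
  qed
qed

text \<open>The sets \<open>D i\<close> of the disjoint augmentations share the edges of \<open>M\<close>, so one of them is no larger than
the average \<open>|M| / (|N| - |M|)\<close>. The hypothesis \<open>short\<close> says that this average is below \<open>r + 1\<close>.\<close>
lemma short_augmentation:
  fixes M N :: "'a set set"
  assumes "finite M" "finite N" "disjoint M" "disjoint N" "\<forall>e\<in>M. card e = 2"
    and short: "Suc r * card M + card M < Suc r * card N"
  obtains D A where "augmentation M N D A" "card D \<le> r"
proof -
  from disjoint_augmentations[OF assms(1-5)] obtain I :: "'a set set" and D A where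
    fI: "finite I" and cI: "card N \<le> card I + card M" and
    dD: "disjoint_family_on D I" and
    aug: "\<forall>i\<in>I. augmentation M N (D i) (A i)"
    by (elim exE conjE) (rule that)
  have DA: "D i \<subseteq> M \<and> A i \<subseteq> N \<and> card (A i) = Suc (card (D i)) \<and>
      (\<forall>e\<in>M - D i. e \<inter> \<Union>(A i) = {})" if "i \<in> I" for i
    using aug that by (simp add: augmentation_def)
  have "\<exists>i\<in>I. card (D i) \<le> r"
  proof (rule ccontr)
    assume "\<not> ?thesis"
    then have "Suc r \<le> card (D i)" if "i \<in> I" for i using that by (auto simp: not_le)
    then have "Suc r * card I \<le> (\<Sum>i\<in>I. card (D i))"
      using sum_bounded_below[of I "Suc r" "\<lambda>i. card (D i)"] by (simp add: mult.commute)
    also have "\<dots> = card (\<Union>i\<in>I. D i)"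
      using fI dD DA finite_subset[OF _ assms(1)] by (intro card_UN_disjoint[symmetric])
        (auto simp: disjoint_family_on_def)
    also have "\<dots> \<le> card M" using DA by (intro card_mono[OF assms(1)] UN_least) blast
    finally have "Suc r * card I \<le> card M" .
    moreover have "Suc r * card N \<le> Suc r * card I + Suc r * card M"
      using mult_le_mono2[OF cI, of "Suc r"] by (simp only: distrib_left)
    ultimately show False using short by linarith
  qed
  then show thesis using that aug by blast
qed

section \<open>Balancing large demands\<close>

text \<open>The term \<open>2 * \<rho> * s\<close> is the first-order effect of a loss \<open>s\<close>; the remainder is small when all demands
\<open>b\<close> are at least a large constant \<open>C\<close>.\<close>
lemma square_deficit_change:
  fixes d s b \<rho> C :: real
  assumes "0 < C" "C \<le> b" "d \<le> \<rho> * b" "0 \<le> s"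
  shows "(d + s)\<^sup>2 / b - d\<^sup>2 / b \<le> 2 * \<rho> * s + s\<^sup>2 / C"
proof -
  have "(d + s)\<^sup>2 / b - d\<^sup>2 / b = 2 * (d / b) * s + s\<^sup>2 / b"
    using assms by (simp add: power2_eq_square field_simps)
  moreover have "d / b \<le> \<rho>" using assms by (simp add: field_simps)
  then have "(d / b) * s \<le> \<rho> * s" using assms by (intro mult_right_mono)
  moreover have "s\<^sup>2 / b \<le> s\<^sup>2 / C" using assms by (intro divide_left_mono) auto
  ultimately show ?thesis by linarith
qed

text \<open>The deficits of the large demands can be made small in proportion, while the total deficit of the
others grows by a constant factor only. Among all matchings that overfulfil no demand, take one that minimises
\<open>\<Phi> = (\<Sum>i\<in>L. d\<^sub>i\<^sup>2 / b\<^sub>i) + (2 / h) * (\<Sum>i\<in>I - L. d\<^sub>i)\<close>, where \<open>d\<^sub>i\<close> is the deficit of \<open>i\<close>. Let \<open>\<rho>\<close> be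
the largest relative deficit \<open>d\<^sub>i / b\<^sub>i\<close> with \<open>i \<in> L\<close>, attained at \<open>i0\<close>, and suppose \<open>\<rho> > 1 / h\<close>. A short augmentation along
\<open>N i0\<close> gains one edge more in the class \<open>i0\<close> than it loses in total. Every lost edge costs at most
\<open>2 * \<rho>\<close> to first order: for classes in \<open>L\<close> by maximality of \<open>\<rho>\<close>, for the others because
\<open>2 / h \<le> 2 * \<rho>\<close>. Hence \<open>\<Phi>\<close> would drop by \<open>2 * \<rho>\<close> up to a quadratic error of at most \<open>2 / h\<close>, which the
lower bound on the large demands makes possible. So all relative deficits in \<open>L\<close> are at most
\<open>1 / h\<close>, and comparing \<open>\<Phi>\<close> with its value at \<open>M0\<close> bounds the deficits outside \<open>L\<close>.\<close>
lemma balanced_matching: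
  fixes N :: "'i \<Rightarrow> 'a set set" and b :: "'i \<Rightarrow> nat" and I L :: "'i set" and h r :: nat
  defines "deficit \<equiv> \<lambda>M i. b i - card (M \<inter> N i)"
  assumes fin: "finite I" and L: "L \<subseteq> I" and h: "2 \<le> h"
    and N: "\<And>i. i \<in> I \<Longrightarrow> finite (N i) \<and> disjoint (N i) \<and> (\<forall>e\<in>N i. card e = 2)"
    and Ndisj: "disjoint_family_on N I"
    and M0: "M0 \<subseteq> (\<Union>i\<in>I. N i)" "disjoint M0" "\<And>i. i \<in> I \<Longrightarrow> card (M0 \<inter> N i) \<le> b i"
    and large: "\<And>i. i \<in> L \<Longrightarrow> (Suc r)\<^sup>2 * h \<le> b i"
    and room: "\<And>i. i \<in> L \<Longrightarrow> (r + 2) * (\<Sum>j\<in>I. b j) < Suc r * card (N i)"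
  obtains M where "M \<subseteq> (\<Union>i\<in>I. N i)" "disjoint M" "\<And>i. i \<in> I \<Longrightarrow> card (M \<inter> N i) \<le> b i"
    "\<And>i. i \<in> L \<Longrightarrow> h * deficit M i \<le> b i"
    "2 * (\<Sum>i\<in>I - L. deficit M i) \<le> h * (\<Sum>i\<in>I. deficit M0 i)"
proof -
  define C where "C = real ((Suc r)\<^sup>2 * h)"
  define \<eta> where "\<eta> = 2 / real h"
  have hpos: "real h > 0" using h by simp
  have Cpos: "C > 0" using h by (simp add: C_def)
  have bC: "C \<le> real (b i)" if "i \<in> L" for i
    using large[OF that] unfolding C_def by (simp only: of_nat_le_iff)
  have \<eta>: "0 < \<eta>" "\<eta> \<le> 1" using h by (auto simp: \<eta>_def)
  define valid where "valid M \<longleftrightarrow> M \<subseteq> (\<Union>i\<in>I. N i) \<and> disjoint M \<and> (\<forall>i\<in>I. card (M \<inter> N i) \<le> b i)" for M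
  define \<phi> where "\<phi> i x = (if i \<in> L then x\<^sup>2 / real (b i) else \<eta> * x)" for i and x :: real
  define \<Phi> where "\<Phi> M = (\<Sum>i\<in>I. \<phi> i (real (deficit M i)))" for M
  have finU: "finite (\<Union>i\<in>I. N i)" using fin N by auto
  have "finite {M. valid M}" using finU by (auto intro: finite_subset[of _ "Pow (\<Union>i\<in>I. N i)"] simp: valid_def)
  moreover have vM0: "valid M0" using M0 by (simp add: valid_def)
  ultimately obtain M where vM: "valid M" and min: "\<And>M'. valid M' \<Longrightarrow> \<Phi> M \<le> \<Phi> M'"
    using arg_min_if_finite[of "{M. valid M}" \<Phi>] by (metis empty_iff mem_Collect_eq not_le)
  have finM: "finite M" using vM finU by (auto simp: valid_def intro: finite_subset)
  have cardM: "card M = (\<Sum>i\<in>I. card (M \<inter> N i))"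
    using card_eq_sum_classes[OF fin finM Ndisj] vM by (simp add: valid_def)
  have Mle: "card M \<le> (\<Sum>i\<in>I. b i)" unfolding cardM using vM by (intro sum_mono) (auto simp: valid_def)
  have M2: "\<forall>e\<in>M. card e = 2" using vM N unfolding valid_def by blast
  have bal: "h * deficit M i \<le> b i" if iL: "i \<in> L" for i
  proof (rule ccontr)
    assume neg: "\<not> ?thesis"
    have finL: "finite L" using fin L finite_subset by blast
    obtain i0 where i0: "i0 \<in> L" and max: "\<And>j. j \<in> L \<Longrightarrow> real (deficit M j) / real (b j) \<le> real (deficit M i0) / real (b i0)"
    proof -
      let ?R = "(\<lambda>j. real (deficit M j) / real (b j)) ` L"
      have "Max ?R \<in> ?R" using finL iL by (intro Max_in) auto
      then obtain i0 where "i0 \<in> L" "Max ?R = real (deficit M i0) / real (b i0)" by auto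
      moreover have "real (deficit M j) / real (b j) \<le> Max ?R" if "j \<in> L" for j
        using finL that by (intro Max_ge) auto
      ultimately show thesis using that by simp
    qed
    define \<rho> where "\<rho> = real (deficit M i0) / real (b i0)"
    have b0: "real (b i0) > 0" using bC[OF i0] Cpos by linarith
    have "real (b i) < real h * real (deficit M i)"
      using neg by (simp only: not_le flip: of_nat_mult of_nat_less_iff)
    moreover have "real (b i) > 0" using bC[OF iL] Cpos by linarith
    ultimately have "1 / real h < real (deficit M i) / real (b i)" using hpos by (simp add: field_simps)
    also have "\<dots> \<le> \<rho>" using max[OF iL] by (simp add: \<rho>_def)
    finally have \<rho>: "1 / real h < \<rho>" .
    have d\<rho>: "real (deficit M j) \<le> \<rho> * real (b j)" if "j \<in> L" for j
    proof -
      have "real (b j) > 0" using bC[OF that] Cpos by linarith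
      then show ?thesis using max[OF that] by (simp add: \<rho>_def field_simps)
    qed
    have d0: "real (deficit M i0) = \<rho> * real (b i0)" using b0 by (simp add: \<rho>_def)
    have i0I: "i0 \<in> I" using i0 L by blast
    have "Suc r * card M + card M = (r + 2) * card M" by simp
    also have "\<dots> \<le> (r + 2) * (\<Sum>j\<in>I. b j)" using Mle by (rule mult_le_mono2)
    also have "\<dots> < Suc r * card (N i0)" by (rule room[OF i0])
    finally obtain D A where aug: "augmentation M (N i0) D A" and Dr: "card D \<le> r"
      using short_augmentation[of M "N i0" r] finM N[OF i0I] vM M2 unfolding valid_def by metis
    have D: "D \<subseteq> M" and A: "A \<subseteq> N i0" and cA: "card A = Suc (card D)"
      and sep: "\<And>e. e \<in> M - D \<Longrightarrow> e \<inter> \<Union>A = {}" using aug by (auto simp: augmentation_def)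
    have finD: "finite D" using D finM finite_subset by blast
    have finA: "finite A" using A N[OF i0I] finite_subset by blast
    have A2: "e \<noteq> {}" if "e \<in> A" for e using subsetD[OF A that] N[OF i0I] by auto
    define M' where "M' = (M - D) \<union> A"
    have disM': "disjoint M'"
      unfolding M'_def
    proof (rule disjoint_exchange)
      show "disjoint M" using vM by (simp add: valid_def)
      show "disjoint A" using N[OF i0I] pairwise_subset[OF _ A] by blast
      show "\<forall>e\<in>M - D. e \<inter> \<Union>A = {}" using sep by blast
    qed
    define s where "s i = card (D \<inter> N i)" for i
    have MDA: "(M - D) \<inter> A = {}"
    proof (rule ccontr)
      assume "\<not> ?thesis"
      then obtain e where e: "e \<in> M - D" "e \<in> A" by blast
      have "e = e \<inter> \<Union>A" using e(2) by blast
      then show False using sep[OF e(1)] A2[OF e(2)] by simp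
    qed
    have m': "card (M' \<inter> N j) + s j = card (M \<inter> N j) + (if j = i0 then card A else 0)" if j: "j \<in> I" for j
    proof -
      have e1: "card ((M - D) \<inter> N j) + s j = card (M \<inter> N j)"
      proof -
        have "card ((M - D) \<inter> N j) + card (D \<inter> N j) = card ((M - D) \<inter> N j \<union> D \<inter> N j)"
          using finM finD by (intro card_Un_disjoint[symmetric]) auto
        also have "(M - D) \<inter> N j \<union> D \<inter> N j = M \<inter> N j" using D by blast
        finally show ?thesis by (simp add: s_def)
      qed
      have "A \<inter> N j = (if j = i0 then A else {})"
        using A Ndisj j i0I by (auto simp: disjoint_family_on_def)
      moreover have "card (M' \<inter> N j) = card ((M - D) \<inter> N j) + card (A \<inter> N j)"
        unfolding M'_def using finM finA MDA by (subst card_Un_disjoint[symmetric]) (auto simp: Int_Un_distrib2)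
      ultimately show ?thesis using e1 by (cases "j = i0") simp_all
    qed
    have mb: "card (M \<inter> N j) \<le> b j" if "j \<in> I" for j using vM that by (simp add: valid_def)
    \<comment> \<open>The deficit of \<open>i0\<close> is large enough for the exchange not to overfulfil the demand.\<close>
    have "real (Suc r) \<le> real (deficit M i0)"
    proof -
      have "real (Suc r) \<le> real ((Suc r)\<^sup>2)" by (simp only: of_nat_le_iff) (simp add: power2_eq_square)
      also have "\<dots> = C / real h" using hpos by (simp add: C_def)
      also have "\<dots> \<le> real (b i0) / real h" using bC[OF i0] hpos by (simp add: divide_right_mono)
      also have "\<dots> \<le> \<rho> * real (b i0)" using \<rho> b0 mult_right_mono[of "1 / real h" \<rho> "real (b i0)"] by simp
      finally show ?thesis by (simp add: d0)
    qed
    then have A_small: "card A \<le> deficit M i0" using cA Dr by (simp only: of_nat_le_iff)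
    have d': "real (deficit M' j) = real (deficit M j) + real (s j) - (if j = i0 then real (card A) else 0)"
      and mb': "card (M' \<inter> N j) \<le> b j" if j: "j \<in> I" for j
      using m'[OF j] mb[OF j] A_small unfolding deficit_def by (auto split: if_splits)
    have vM': "valid M'"
      using vM D A i0I disM' mb' unfolding valid_def M'_def by blast
    have step: "\<phi> j (real (deficit M' j)) - \<phi> j (real (deficit M j)) \<le> 2 * \<rho> * real (s j) + (real (s j))\<^sup>2 / C" 
      if j: "j \<in> I" "j \<noteq> i0" for j
    proof (cases "j \<in> L")
      case True
      then show ?thesis using square_deficit_change[OF Cpos bC[OF True] d\<rho>[OF True], of "real (s j)"] d'[OF j(1)] j
        by (simp add: \<phi>_def)
    next
      case False
      have "\<eta> * real (s j) \<le> 2 * \<rho> * real (s j)" using \<rho> by (intro mult_right_mono) (auto simp: \<eta>_def)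
      moreover have "0 \<le> (real (s j))\<^sup>2 / C" using Cpos by simp
      ultimately show ?thesis using False d'[OF j(1)] j by (simp add: \<phi>_def algebra_simps)
    qed
    have s_sum: "(\<Sum>j\<in>I. s j) = card D"
      using card_eq_sum_classes[OF fin finD Ndisj] D vM by (auto simp: valid_def s_def)
    have step0: "\<phi> i0 (real (deficit M' i0)) - \<phi> i0 (real (deficit M i0))
        = 2 * \<rho> * (real (s i0) - real (card A)) + (real (s i0) - real (card A))\<^sup>2 / real (b i0)"
    proof -
      have "(x + y)\<^sup>2 / real (b i0) - x\<^sup>2 / real (b i0) = 2 * (x / real (b i0)) * y + y\<^sup>2 / real (b i0)" for x y :: real
        using b0 by (simp add: power2_eq_square field_simps)
      from this[of "real (deficit M i0)" "real (s i0) - real (card A)"]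
      have "(real (deficit M i0) + (real (s i0) - real (card A)))\<^sup>2 / real (b i0) - (real (deficit M i0))\<^sup>2 / real (b i0)
          = 2 * \<rho> * (real (s i0) - real (card A)) + (real (s i0) - real (card A))\<^sup>2 / real (b i0)"
        by (simp only: \<rho>_def)
      moreover have "real (deficit M' i0) = real (deficit M i0) + (real (s i0) - real (card A))"
        using d'[OF i0I] by simp
      ultimately show ?thesis using i0 by (simp only: \<phi>_def if_True)
    qed
    have sD: "s i0 \<le> card D" unfolding s_def using finD by (intro card_mono) auto
    have quad0: "(real (s i0) - real (card A))\<^sup>2 / real (b i0) \<le> (real (card A) - real (s i0))\<^sup>2 / C"
      unfolding power2_commute[of "real (s i0)"] using bC[OF i0] Cpos b0 by (intro divide_left_mono) auto
    have rest: "(\<Sum>j\<in>I-{i0}. real (s j)) = real (card D) - real (s i0)"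
      using s_sum fin i0I by (subst sum_diff1) (auto simp flip: of_nat_sum)
    have "\<Phi> M' - \<Phi> M = (\<Sum>j\<in>I. \<phi> j (real (deficit M' j)) - \<phi> j (real (deficit M j)))"
      by (simp add: \<Phi>_def sum_subtractf)
    also have "\<dots> = (\<phi> i0 (real (deficit M' i0)) - \<phi> i0 (real (deficit M i0))) +
       (\<Sum>j\<in>I-{i0}. \<phi> j (real (deficit M' j)) - \<phi> j (real (deficit M j)))"
      using fin i0I by (simp add: sum.remove)
    also have "(\<Sum>j\<in>I-{i0}. \<phi> j (real (deficit M' j)) - \<phi> j (real (deficit M j))) \<le>
       (\<Sum>j\<in>I-{i0}. 2 * \<rho> * real (s j) + (real (s j))\<^sup>2 / C)" using step by (intro sum_mono) auto
    also have "\<dots> = 2 * \<rho> * (real (card D) - real (s i0)) + (\<Sum>j\<in>I-{i0}. (real (s j))\<^sup>2) / C"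
      by (simp add: sum.distrib sum_divide_distrib rest flip: sum_distrib_left)
    also have "(\<Sum>j\<in>I-{i0}. (real (s j))\<^sup>2) / C \<le> (real (card D) - real (s i0))\<^sup>2 / C"
    proof -
      have "(\<Sum>j\<in>I-{i0}. (real (s j))\<^sup>2) \<le> (\<Sum>j\<in>I-{i0}. real (s j) * (\<Sum>j\<in>I-{i0}. real (s j)))"
        unfolding power2_eq_square
        using fin by (intro sum_mono mult_left_mono member_le_sum) auto
      also have "\<dots> = (real (card D) - real (s i0))\<^sup>2"
        by (simp add: rest power2_eq_square flip: sum_distrib_right)
      finally show ?thesis using Cpos by (simp add: divide_right_mono)
    qed
    finally have "\<Phi> M' - \<Phi> M \<le> 2 * \<rho> * (real (card D) - real (card A))
        + ((real (card A) - real (s i0))\<^sup>2 + (real (card D) - real (s i0))\<^sup>2) / C"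
      using step0 quad0 by (simp add: algebra_simps add_divide_distrib)
    moreover have "(real (card A) - real (s i0))\<^sup>2 \<le> (real (Suc r))\<^sup>2"
      using sD cA Dr by (intro power_mono) auto
    moreover have "(real (card D) - real (s i0))\<^sup>2 \<le> (real (Suc r))\<^sup>2"
      using sD Dr by (intro power_mono) auto
    ultimately have "\<Phi> M' - \<Phi> M \<le> 2 * \<rho> * (real (card D) - real (card A)) + (2 * (real (Suc r))\<^sup>2) / C"
      using Cpos divide_right_mono[of "(real (card A) - real (s i0))\<^sup>2 + (real (card D) - real (s i0))\<^sup>2" "2 * (real (Suc r))\<^sup>2" C]
      by linarith
    also have "2 * \<rho> * (real (card D) - real (card A)) = - 2 * \<rho>" by (simp add: cA)
    also have "(2 * (real (Suc r))\<^sup>2) / C = 2 * (1 / real h)"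
      using hpos by (simp add: C_def del: of_nat_Suc)
    finally have "\<Phi> M' - \<Phi> M < 0" using \<rho> by linarith
    then show False using min[OF vM'] by linarith
  qed
  have "\<eta> * (\<Sum>i\<in>I-L. real (deficit M i)) \<le> \<Phi> M"
  proof -
    have "\<eta> * (\<Sum>i\<in>I-L. real (deficit M i)) = (\<Sum>i\<in>I-L. \<phi> i (real (deficit M i)))"
      by (simp add: \<phi>_def sum_distrib_left)
    also have "\<dots> \<le> \<Phi> M" unfolding \<Phi>_def
      using fin \<eta> by (intro sum_mono2) (auto simp: \<phi>_def)
    finally show ?thesis .
  qed
  also have "\<Phi> M \<le> \<Phi> M0" by (rule min[OF vM0])
  also have "\<Phi> M0 \<le> (\<Sum>i\<in>I. real (deficit M0 i))" unfolding \<Phi>_def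
  proof (rule sum_mono)
    fix i assume "i \<in> I"
    show "\<phi> i (real (deficit M0 i)) \<le> real (deficit M0 i)"
    proof (cases "i \<in> L")
      case True
      have "real (b i) > 0" using bC[OF True] Cpos by linarith
      moreover have "real (deficit M0 i) * real (deficit M0 i) \<le> real (deficit M0 i) * real (b i)"
        by (intro mult_left_mono) (auto simp: deficit_def)
      ultimately show ?thesis using True by (simp add: \<phi>_def power2_eq_square field_simps)
    next
      case False
      then show ?thesis using \<eta> mult_right_mono[of \<eta> 1 "real (deficit M0 i)"] by (simp add: \<phi>_def)
    qed
  qed
  finally have "2 * (\<Sum>i\<in>I-L. real (deficit M i)) \<le> real h * (\<Sum>i\<in>I. real (deficit M0 i))"
    using hpos by (simp add: \<eta>_def field_simps)
  then have "real (2 * (\<Sum>i\<in>I-L. deficit M i)) \<le> real (h * (\<Sum>i\<in>I. deficit M0 i))" by simp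
  then have "2 * (\<Sum>i\<in>I-L. deficit M i) \<le> h * (\<Sum>i\<in>I. deficit M0 i)" by (simp only: of_nat_le_iff)
  moreover have "M \<subseteq> (\<Union>i\<in>I. N i)" "disjoint M" "\<And>i. i \<in> I \<Longrightarrow> card (M \<inter> N i) \<le> b i"
    using vM by (simp_all add: valid_def)
  ultimately show thesis using bal by (intro that)
qed

section \<open>Matchings in slot hypergraphs\<close>

text \<open>A colour with demand \<open>b\<close> is replaced by \<open>b\<close> slots, each of which is a copy of the perfect matching of
that colour. A slot \<open>s\<close> enters only through its partner function \<open>\<pi> s\<close>. Vertices and slots
live in one type, so that a coloured edge becomes a set of three points, a rainbow matching becomes
a disjoint family of such sets, and freeing a vertex and freeing a slot are the same notion. What
makes the argument work is that every vertex lies in an edge with every slot, while two vertices lie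
together in at most \<open>\<mu>\<close> edges.\<close>
locale slot_hypergraph =
  fixes V S :: "'a set" and \<pi> :: "'a \<Rightarrow> 'a \<Rightarrow> 'a" and \<mu> :: nat
  assumes finite_V: "finite V" and finite_S: "finite S" and VS: "V \<inter> S = {}"
    and partner_in: "\<And>s v. s \<in> S \<Longrightarrow> v \<in> V \<Longrightarrow> \<pi> s v \<in> V"
    and partner_partner: "\<And>s v. s \<in> S \<Longrightarrow> v \<in> V \<Longrightarrow> \<pi> s (\<pi> s v) = v"
    and partner_ne: "\<And>s v. s \<in> S \<Longrightarrow> v \<in> V \<Longrightarrow> \<pi> s v \<noteq> v"
    and codegree: "\<And>u v. u \<in> V \<Longrightarrow> v \<in> V \<Longrightarrow> card {s \<in> S. \<pi> s u = v} \<le> \<mu>"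
begin

definition hedge :: "'a \<Rightarrow> 'a \<Rightarrow> 'a set" where
  "hedge s v = {v, \<pi> s v, s}"

definition H :: "'a set set" where
  "H = {hedge s v | s v. s \<in> S \<and> v \<in> V}"

lemma hedge_in_H: "s \<in> S \<Longrightarrow> v \<in> V \<Longrightarrow> hedge s v \<in> H"
  by (auto simp: H_def)

lemma H_subset: "h \<in> H \<Longrightarrow> h \<subseteq> V \<union> S"
  using partner_in by (auto simp: H_def hedge_def)

lemma finite_H: "finite H"
  using H_subset finite_V finite_S by (intro finite_subset[of H "Pow (V \<union> S)"]) auto

lemma finite_hedge: "h \<in> H \<Longrightarrow> finite h"
  by (auto simp: H_def hedge_def)

lemma card_hedge: "h \<in> H \<Longrightarrow> card h = 3"
  using partner_ne partner_in VS by (force simp: H_def hedge_def card_insert_if)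

lemma hedge_nonempty: "h \<in> H \<Longrightarrow> h \<noteq> {}"
  by (auto simp: H_def hedge_def)

lemma hedge_vertices: "h \<in> H \<Longrightarrow> card (V \<inter> h) = 2"
proof -
  assume "h \<in> H"
  then obtain s v where sv: "s \<in> S" "v \<in> V" "h = hedge s v" by (auto simp: H_def)
  then have "V \<inter> h = {v, \<pi> s v}" using partner_in VS by (auto simp: hedge_def)
  then show ?thesis using partner_ne[OF sv(1,2)] by auto
qed

lemma hedge_slots: "h \<in> H \<Longrightarrow> card (S \<inter> h) = 1"
proof -
  assume "h \<in> H"
  then obtain s v where sv: "s \<in> S" "v \<in> V" "h = hedge s v" by (auto simp: H_def)
  then have "S \<inter> h = {s}" using partner_in VS by (auto simp: hedge_def)
  then show ?thesis by simp
qed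

lemma hedge_eqI:
  assumes "h \<in> H" "s \<in> h" "s \<in> S" "v \<in> h" "v \<in> V"
  shows "h = hedge s v"
proof -
  obtain t w where tw: "t \<in> S" "w \<in> V" "h = hedge t w" using assms(1) by (auto simp: H_def)
  have "s = t" using assms tw partner_in VS by (auto simp: hedge_def)
  moreover have "v = w \<or> v = \<pi> t w" using assms tw VS by (auto simp: hedge_def)
  ultimately show ?thesis using tw partner_partner by (auto simp: hedge_def)
qed

end

locale maximum_slot_matching = slot_hypergraph +
  fixes M :: "'a set set"
  assumes M_H: "M \<subseteq> H" and M_disjoint: "disjoint M"
    and M_max: "\<And>M'. M' \<subseteq> H \<Longrightarrow> disjoint M' \<Longrightarrow> card M' \<le> card M"
begin

lemma finite_M: "finite M"
  using M_H finite_H finite_subset by blast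

definition free :: "'a set" where
  "free = V \<union> S - \<Union>M"

text \<open>To uncover a covered point, one has to remove its whole edge from \<open>M\<close>. Therefore the simultaneous
treatment of several points requires that their cells, and not just the points, are kept apart.\<close>
definition cell :: "'a \<Rightarrow> 'a set" where
  "cell z = (if z \<in> \<Union>M then (THE e. e \<in> M \<and> z \<in> e) else {z})"

lemma M_unique: "e \<in> M \<Longrightarrow> f \<in> M \<Longrightarrow> z \<in> e \<Longrightarrow> z \<in> f \<Longrightarrow> e = f"
  using M_disjoint unfolding pairwise_def disjnt_def by blast

lemma cell_edge: "e \<in> M \<Longrightarrow> z \<in> e \<Longrightarrow> cell z = e"
proof -
  assume e: "e \<in> M" "z \<in> e"
  then have "(THE e. e \<in> M \<and> z \<in> e) = e" using M_unique by (intro the_equality) auto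
  then show ?thesis using e by (auto simp: cell_def)
qed

lemma cell_in_M: "z \<in> \<Union>M \<Longrightarrow> cell z \<in> M"
  using cell_edge by auto

lemma cell_uncovered: "z \<notin> \<Union>M \<Longrightarrow> cell z = {z}"
  by (simp add: cell_def)

lemma in_cell: "z \<in> cell z"
  using cell_edge cell_uncovered by (cases "z \<in> \<Union>M") auto

lemma cell_eq: "y \<in> cell z \<Longrightarrow> cell y = cell z"
  using cell_edge cell_uncovered by (cases "z \<in> \<Union>M") auto

lemma cell_disjoint: "cell y \<noteq> cell z \<Longrightarrow> cell y \<inter> cell z = {}"
  using cell_eq by blast

lemma finite_cell: "finite (cell z)"
proof (cases "z \<in> \<Union>M")
  case True
  then show ?thesis using cell_in_M[OF True] M_H finite_hedge by blast
qed (simp add: cell_uncovered)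

lemma card_cell: "card (cell z) \<le> 3"
proof (cases "z \<in> \<Union>M")
  case True
  then show ?thesis using cell_in_M M_H card_hedge by fastforce
qed (simp add: cell_uncovered)

lemma card_UN_cell: "finite F \<Longrightarrow> card (\<Union>z\<in>F. cell z) \<le> 3 * card F"
  using card_UN_le[of F cell] sum_bounded_above[of F "\<lambda>z. card (cell z)" 3] card_cell
  by (simp add: mult.commute)

text \<open>All consequences of maximality are drawn in this local form: \<open>D\<close> cannot be replaced by a larger family
that uses only the points of \<open>D\<close> and uncovered points.\<close>
lemma exchange_bound:
  assumes D: "D \<subseteq> M" and A: "A \<subseteq> H" "disjoint A" and sub: "\<Union>A \<subseteq> \<Union>D \<union> free"
  shows "card A \<le> card D"
proof -
  have sep: "e \<inter> \<Union>A = {}" if "e \<in> M - D" for e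
  proof -
    have "e \<inter> \<Union>D = {}" using that D M_unique by blast
    moreover have "e \<inter> free = {}" using that by (auto simp: free_def)
    ultimately show ?thesis using sub by blast
  qed
  have "disjoint (M - D \<union> A)"
    using sep by (intro disjoint_exchange M_disjoint A) auto
  moreover have "M - D \<union> A \<subseteq> H" using M_H A by auto
  ultimately have "card (M - D \<union> A) \<le> card M" by (intro M_max)
  moreover have "(M - D) \<inter> A = {}"
  proof (rule ccontr)
    assume "\<not> ?thesis"
    then obtain e where e: "e \<in> M - D" "e \<in> A" by blast
    have "e = e \<inter> \<Union>A" using e(2) by blast
    then have "e = {}" using sep[OF e(1)] by simp
    moreover have "e \<in> H" using e A by blast
    ultimately show False using hedge_nonempty by blast
  qed
  moreover have "finite A" using A finite_H finite_subset by blast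
  moreover have "card (M - D) + card D = card M"
    using D finite_M card_mono[OF finite_M D] by (simp add: card_Diff_subset finite_subset)
  ultimately show ?thesis using finite_M by (simp add: card_Un_disjoint)
qed

text \<open>A switch replaces edges of \<open>M\<close> by equally many others, so it leads to another maximum matching. Two
switches with disjoint footprints can be performed together. Switches serve to uncover prescribed
points, which must then lie in \<open>freed\<close>.\<close>
definition switch :: "'a set set \<Rightarrow> 'a set set \<Rightarrow> bool" where
  "switch D A \<longleftrightarrow> D \<subseteq> M \<and> A \<subseteq> H \<and> disjoint A \<and> card A = card D \<and> \<Union>A \<subseteq> \<Union>D \<union> free"

definition footprint :: "'a set set \<Rightarrow> 'a set set \<Rightarrow> 'a set" where
  "footprint D A = \<Union>D \<union> \<Union>A"

definition freed :: "'a set set \<Rightarrow> 'a set set \<Rightarrow> 'a set" where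
  "freed D A = (\<Union>D \<union> free) - \<Union>A"

lemma switchD:
  assumes "switch D A"
  shows "D \<subseteq> M" "A \<subseteq> H" "disjoint A" "card A = card D" "\<Union>A \<subseteq> \<Union>D \<union> free" "finite D" "finite A"
  using assms finite_M finite_H by (auto simp: switch_def intro: finite_subset)

lemma H_family_disjoint:
  assumes "A \<subseteq> H" "\<Union>A \<inter> \<Union>B = {}"
  shows "A \<inter> B = {}"
proof (rule ccontr)
  assume "A \<inter> B \<noteq> {}"
  then obtain e where "e \<in> A" "e \<in> B" by blast
  moreover have "e \<noteq> {}" using \<open>e \<in> A\<close> assms(1) hedge_nonempty by blast
  ultimately show False using assms(2) by blast
qed

lemma switch_Un:
  assumes "switch D1 A1" "switch D2 A2" "footprint D1 A1 \<inter> footprint D2 A2 = {}"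
  shows "switch (D1 \<union> D2) (A1 \<union> A2)" "card (D1 \<union> D2) = card D1 + card D2"
proof -
  note 1 = switchD[OF assms(1)] and 2 = switchD[OF assms(2)]
  have A: "\<Union>A1 \<inter> \<Union>A2 = {}" and D: "\<Union>D1 \<inter> \<Union>D2 = {}"
    using assms(3) unfolding footprint_def by blast+
  have "A1 \<inter> A2 = {}" using H_family_disjoint[OF 1(2) A] .
  moreover have "D1 \<inter> D2 = {}" using H_family_disjoint[OF _ D] 1(1) M_H by blast
  ultimately show "card (D1 \<union> D2) = card D1 + card D2" and "switch (D1 \<union> D2) (A1 \<union> A2)"
    using 1 2 disjoint_Un[OF 1(3) 2(3) A] by (auto simp: switch_def card_Un_disjoint)
qed

lemma card_footprint:
  assumes "switch D A"
  shows "finite (footprint D A)" "card (footprint D A) \<le> 6 * card D"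
proof -
  note s = switchD[OF assms]
  have U: "finite (\<Union>B) \<and> card (\<Union>B) \<le> 3 * card B" if "B \<subseteq> H" "finite B" for B
  proof
    show "finite (\<Union>B)" using that finite_hedge by blast
    have "card (\<Union>B) \<le> (\<Sum>h\<in>B. card h)" using that finite_hedge by (intro card_Union_le_sum_card)
    also have "\<dots> = (\<Sum>h\<in>B. 3)" using that card_hedge by (intro sum.cong) auto
    finally show "card (\<Union>B) \<le> 3 * card B" by simp
  qed
  have "D \<subseteq> H" using s(1) M_H by blast
  then show "finite (footprint D A)" "card (footprint D A) \<le> 6 * card D"
    using U[of D] U[of A] s card_Un_le[of "\<Union>D" "\<Union>A"] by (auto simp: footprint_def)
qed

text \<open>From a set \<open>X\<close> of pivots, one vertex \<open>x\<close> in each of some edges of \<open>M\<close>, one gets the points that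
switching those edges can uncover: \<open>x\<close> is covered anew by another edge, and the other vertex and the
slot of its old edge become exposed, as are the points that \<open>M\<close> leaves uncovered.\<close>
definition exposed :: "'a set \<Rightarrow> 'a set" where
  "exposed X = free \<union> (\<Union>x\<in>X. cell x - {x})"

definition pivot_set :: "'a set \<Rightarrow> bool" where
  "pivot_set X \<longleftrightarrow> X \<subseteq> V \<inter> \<Union>M \<and> inj_on cell X"

text \<open>Every exposed point can be freed by a switch of at most \<open>c\<close> edges that stays away from \<open>f\<close> prescribed
points. The freedom to avoid points is what allows several points to be freed simultaneously.\<close>
definition robust :: "'a set \<Rightarrow> nat \<Rightarrow> nat \<Rightarrow> bool" where
  "robust X c f \<longleftrightarrow> (\<forall>z\<in>exposed X. \<forall>F. finite F \<and> card F \<le> f \<and> cell z \<inter> F = {} \<longrightarrow>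
     (\<exists>D A. switch D A \<and> card D \<le> c \<and> footprint D A \<inter> F = {} \<and> z \<in> freed D A))"

text \<open>The candidates for new pivots: vertices of edges of \<open>M\<close> without pivot that have at least \<open>B\<close> edges to an
exposed vertex in an exposed slot. With that many choices, some choice avoids any given few points.\<close>
definition good :: "'a set \<Rightarrow> nat \<Rightarrow> 'a set" where
  "good X B = {x \<in> V \<inter> \<Union>M. cell x \<inter> X = {} \<and> B \<le> card {t \<in> exposed X \<inter> S. \<pi> t x \<in> exposed X}}"

lemma pivot_not_exposed:
  assumes "pivot_set X" "x \<in> X"
  shows "x \<notin> exposed X"
proof
  assume "x \<in> exposed X"
  moreover have "x \<in> \<Union>M" using assms by (auto simp: pivot_set_def)
  ultimately obtain y where "y \<in> X" "x \<in> cell y" "x \<noteq> y" by (auto simp: exposed_def free_def)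
  moreover have "inj_on cell X" using assms by (simp add: pivot_set_def)
  ultimately show False using assms(2) cell_eq[of x y] inj_onD[of cell X x y] by simp
qed

lemma exposed_edge:
  assumes "e \<in> M" "z \<in> e" "z \<in> exposed X"
  obtains x where "x \<in> X" "x \<in> e"
proof -
  have "z \<notin> free" using assms by (auto simp: free_def)
  then obtain x where x: "x \<in> X" "z \<in> cell x" using assms(3) by (auto simp: exposed_def)
  then have "cell x = e" using cell_eq[OF x(2)] cell_edge[OF assms(1,2)] by simp
  then show thesis using that x(1) in_cell by blast
qed

text \<open>Points of one hyperedge can be freed simultaneously only if they lie in different cells. This lemma
excludes the other case: an exposed vertex and an exposed slot of one cell determine that cell as
their hyperedge, so its pivot lies in \<open>h\<close>; and two exposed vertices of one cell leave no
vertex for its pivot.\<close>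
lemma same_cell_exposed:
  assumes X: "pivot_set X" and h: "h \<in> H" "a \<in> h" "b \<in> h" and ab: "a \<noteq> b" "cell a = cell b"
    and ex: "a \<in> exposed X" "b \<in> exposed X"
  shows "h \<in> M \<and> h \<inter> X \<noteq> {}"
proof -
  have "a \<in> \<Union>M" using ab cell_uncovered[of a] in_cell[of b] by (cases "a \<in> \<Union>M") auto
  then obtain e where e: "e \<in> M" "a \<in> e" by blast
  then have be: "b \<in> e" using ab cell_edge[OF e] in_cell[of b] by simp
  have eH: "e \<in> H" using e M_H by blast
  obtain x where x: "x \<in> X" "x \<in> e" using exposed_edge[OF e ex(1)] by blast
  have xne: "x \<noteq> a" "x \<noteq> b" using pivot_not_exposed[OF X x(1)] ex by auto
  have "\<not> (a \<in> V \<and> b \<in> V)"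
  proof
    assume "a \<in> V \<and> b \<in> V"
    moreover have "x \<in> V" using x X by (auto simp: pivot_set_def)
    ultimately have "{a, b, x} \<subseteq> V \<inter> e" using e be x by auto
    then have "card {a, b, x} \<le> card (V \<inter> e)" using finite_V by (intro card_mono) auto
    then show False using xne ab(1) hedge_vertices[OF eH] by auto
  qed
  moreover have "\<not> (a \<in> S \<and> b \<in> S)"
  proof
    assume "a \<in> S \<and> b \<in> S"
    then have "card {a, b} \<le> card (S \<inter> e)" using finite_S e be by (intro card_mono) auto
    then show False using ab(1) hedge_slots[OF eH] by auto
  qed
  moreover have "a \<in> V \<union> S" "b \<in> V \<union> S" using H_subset[OF h(1)] h by auto
  ultimately have "(a \<in> S \<and> b \<in> V) \<or> (a \<in> V \<and> b \<in> S)" by blast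
  then have "e = h"
    using hedge_eqI[OF eH] hedge_eqI[OF h(1)] e be h by metis
  then show ?thesis using e x by auto
qed

lemma robust_empty: "robust {} 0 f"
  unfolding robust_def
proof (intro ballI allI impI)
  fix z F assume "z \<in> exposed {}" 
  then have "switch {} {} \<and> card ({} :: 'a set set) \<le> 0 \<and> footprint {} {} \<inter> F = {} \<and> z \<in> freed {} {}"
    by (auto simp: exposed_def switch_def footprint_def freed_def)
  then show "\<exists>D A. switch D A \<and> card D \<le> 0 \<and> footprint D A \<inter> F = {} \<and> z \<in> freed D A" by blast
qed

lemma robustD:
  assumes "robust X c f" "z \<in> exposed X" "finite F" "card F \<le> f" "cell z \<inter> F = {}"
  obtains D A where "switch D A" "card D \<le> c" "footprint D A \<inter> F = {}" "z \<in> freed D A"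
  using assms unfolding robust_def by blast

text \<open>The switches are chosen one after another. Each has to avoid the footprints of the others and the
cells of the points still to be freed; a footprint has at most \<open>6 * c\<close> points and a cell at most 3.\<close>
lemma robust_simultaneous:
  assumes rob: "robust X c f" and W: "finite W" "W \<subseteq> exposed X" "inj_on cell W"
    and F: "finite F" "card F + card W * (6 * c + 3) \<le> f" "\<forall>w\<in>W. cell w \<inter> F = {}"
  shows "\<exists>D A. switch D A \<and> card D \<le> card W * c \<and> footprint D A \<inter> F = {} \<and> W \<subseteq> freed D A"
  using W F
proof (induction W arbitrary: F rule: finite_induct)
  case empty
  have "switch {} {} \<and> card {} \<le> card {} * c \<and> footprint {} {} \<inter> F = {} \<and> {} \<subseteq> freed {} {}"
    by (simp add: switch_def footprint_def)
  then show ?case by blast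
next
  case (insert z W)
  have sepW: "cell w \<inter> cell z = {}" if "w \<in> W" for w
  proof (rule cell_disjoint)
    show "cell w \<noteq> cell z" using insert.prems(2) insert.hyps(2) that by (auto dest: inj_onD)
  qed
  have cW: "card (insert z W) = Suc (card W)" using insert.hyps by simp
  have "card (F \<union> cell z) \<le> card F + 3" using card_Un_le[of F "cell z"] card_cell[of z] by linarith
  then have "card (F \<union> cell z) + card W * (6 * c + 3) \<le> f" using insert.prems(4) cW by simp
  moreover have "\<forall>w\<in>W. cell w \<inter> (F \<union> cell z) = {}" using sepW insert.prems(5) by blast
  moreover have "W \<subseteq> exposed X" "inj_on cell W" "finite (F \<union> cell z)"
    using insert.prems finite_cell by auto
  ultimately obtain D1 A1 where 1: "switch D1 A1" "card D1 \<le> card W * c"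
    "footprint D1 A1 \<inter> (F \<union> cell z) = {}" "W \<subseteq> freed D1 A1"
    using insert.IH[of "F \<union> cell z"] by blast
  let ?F = "F \<union> footprint D1 A1 \<union> (\<Union>w\<in>W. cell w)"
  have "finite ?F" using insert.prems(3) insert.hyps card_footprint[OF 1(1)] finite_cell by auto
  moreover have "card ?F \<le> f"
  proof -
    have "card ?F \<le> card F + card (footprint D1 A1) + card (\<Union>w\<in>W. cell w)"
      using card_Un_le[of "F \<union> footprint D1 A1" "\<Union>w\<in>W. cell w"] card_Un_le[of F "footprint D1 A1"] by linarith
    also have "\<dots> \<le> card F + 6 * (card W * c) + 3 * card W"
      using card_footprint(2)[OF 1(1)] 1(2) card_UN_cell[OF insert.hyps(1)] by linarith
    also have "\<dots> \<le> f" using insert.prems(4) cW by (simp add: algebra_simps)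
    finally show ?thesis .
  qed
  moreover have "cell z \<inter> ?F = {}" using insert.prems(5) 1(3) sepW by blast
  moreover have "z \<in> exposed X" using insert.prems(1) by blast
  ultimately obtain D2 A2 where 2: "switch D2 A2" "card D2 \<le> c" "footprint D2 A2 \<inter> ?F = {}" "z \<in> freed D2 A2"
    using robustD[OF rob] by metis
  have foot: "footprint D1 A1 \<inter> footprint D2 A2 = {}" using 2(3) by blast
  have "z \<in> freed (D1 \<union> D2) (A1 \<union> A2)"
    using 2(4) 1(3) in_cell[of z] by (auto simp: freed_def footprint_def)
  moreover have "W \<subseteq> freed (D1 \<union> D2) (A1 \<union> A2)"
  proof
    fix w assume w: "w \<in> W"
    then have "w \<notin> footprint D2 A2" using 2(3) in_cell[of w] by blast
    then show "w \<in> freed (D1 \<union> D2) (A1 \<union> A2)" using 1(4) w by (auto simp: freed_def footprint_def)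
  qed
  moreover have "footprint (D1 \<union> D2) (A1 \<union> A2) \<inter> F = {}"
    using 1(3) 2(3) by (auto simp: footprint_def)
  ultimately have "switch (D1 \<union> D2) (A1 \<union> A2) \<and> card (D1 \<union> D2) \<le> card (insert z W) * c \<and>
     footprint (D1 \<union> D2) (A1 \<union> A2) \<inter> F = {} \<and> insert z W \<subseteq> freed (D1 \<union> D2) (A1 \<union> A2)"
    using switch_Un[OF 1(1) 2(1) foot] 1(2) 2(2) cW by simp
  then show ?case by blast
qed

text \<open>Otherwise the three points of \<open>h\<close> could be freed by switches, and \<open>h\<close> could be added to the matching,
contradicting its maximality.\<close>
lemma no_exposed_hedge:
  assumes X: "pivot_set X" and rob: "robust X c f" and f: "3 * (6 * c + 3) \<le> f" and h: "h \<in> H"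
  shows "\<not> h \<subseteq> exposed X"
proof
  assume sub: "h \<subseteq> exposed X"
  have "inj_on cell h"
  proof (rule inj_onI, rule ccontr)
    fix a b assume ab: "a \<in> h" "b \<in> h" "cell a = cell b" "a \<noteq> b"
    then have "h \<inter> X \<noteq> {}" using same_cell_exposed[OF X h ab(1,2,4,3)] sub by blast
    then show False using pivot_not_exposed[OF X] sub by blast
  qed
  then obtain D A where s: "switch D A" "h \<subseteq> freed D A"
    using robust_simultaneous[OF rob finite_hedge[OF h] sub, of "{}"] f card_hedge[OF h] by auto
  note sw = switchD[OF s(1)]
  have hA: "\<Union>A \<inter> \<Union>{h} = {}" using s(2) by (auto simp: freed_def)
  have "A \<inter> {h} = {}" using H_family_disjoint[OF sw(2) hA] .
  then have "card (A \<union> {h}) = Suc (card D)" using sw by simp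
  moreover have "card (A \<union> {h}) \<le> card D"
  proof (rule exchange_bound)
    show "disjoint (A \<union> {h})" using sw(3) hA by (intro disjoint_Un) auto
    show "\<Union>(A \<union> {h}) \<subseteq> \<Union>D \<union> free" using sw(5) s(2) by (auto simp: freed_def)
  qed (use sw h in auto)
  ultimately show False by simp
qed

text \<open>At most \<open>3 * card F\<close> points have a cell that meets \<open>F\<close>. Such a point rules out one pair \<open>(t, \<pi> t x)\<close> in
its role as a slot, and at most \<open>\<mu>\<close> pairs in its role as a vertex.\<close>
lemma good_choice:
  assumes X: "pivot_set X" and x: "x \<in> good X B" and F: "finite F" "3 * card F * (\<mu> + 1) < B"
  obtains t where "t \<in> S" "t \<in> exposed X" "\<pi> t x \<in> exposed X" "cell t \<inter> F = {}" "cell (\<pi> t x) \<inter> F = {}"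
    "cell t \<noteq> cell (\<pi> t x)"
proof -
  define C where "C = (\<Union>z\<in>F. cell z)"
  have xV: "x \<in> V" and xX: "cell x \<inter> X = {}" and B: "B \<le> card {t \<in> exposed X \<inter> S. \<pi> t x \<in> exposed X}"
    using x by (auto simp: good_def)
  have finC: "finite C" using F finite_cell by (auto simp: C_def)
  have cC: "card C \<le> 3 * card F" unfolding C_def by (rule card_UN_cell[OF F(1)])
  have inC: "z \<in> C" if meet: "cell z \<inter> F \<noteq> {}" for z
  proof -
    obtain y where y: "y \<in> cell z" "y \<in> F" using meet by blast
    have "z \<in> cell y" using cell_eq[OF y(1)] in_cell[of z] by simp
    then show ?thesis using y(2) by (auto simp: C_def)
  qed
  have "\<exists>t\<in>{t \<in> exposed X \<inter> S. \<pi> t x \<in> exposed X}. t \<notin> C \<and> \<pi> t x \<notin> C"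
  proof (rule ccontr)
    assume "\<not> ?thesis"
    then have sub: "{t \<in> exposed X \<inter> S. \<pi> t x \<in> exposed X} \<subseteq> C \<union> (\<Union>u\<in>C \<inter> V. {s \<in> S. \<pi> s x = u})"
      using partner_in xV by blast
    have "B \<le> card (C \<union> (\<Union>u\<in>C \<inter> V. {s \<in> S. \<pi> s x = u}))"
      using B card_mono[OF _ sub] finC finite_S by fastforce
    also have "\<dots> \<le> card C + card (\<Union>u\<in>C \<inter> V. {s \<in> S. \<pi> s x = u})" by (rule card_Un_le)
    also have "card (\<Union>u\<in>C \<inter> V. {s \<in> S. \<pi> s x = u}) \<le> (\<Sum>u\<in>C \<inter> V. card {s \<in> S. \<pi> s x = u})"
      using finC by (intro card_UN_le) auto
    also have "\<dots> \<le> (\<Sum>u\<in>C \<inter> V. \<mu>)" using codegree xV by (intro sum_mono) auto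
    also have "\<dots> \<le> card C * \<mu>" using finC by (simp add: card_mono)
    also have "card C + card C * \<mu> = card C * (\<mu> + 1)" by simp
    also have "\<dots> \<le> 3 * card F * (\<mu> + 1)" using cC by (rule mult_le_mono1)
    finally show False using F(2) by simp
  qed
  then obtain t where t: "t \<in> exposed X" "t \<in> S" "\<pi> t x \<in> exposed X" "t \<notin> C" "\<pi> t x \<notin> C" by blast
  have "cell t \<noteq> cell (\<pi> t x)"
  proof
    assume eq: "cell t = cell (\<pi> t x)"
    have ne: "t \<noteq> \<pi> t x" using t(2) partner_in[OF t(2) xV] VS by auto
    have "hedge t x \<in> M \<and> hedge t x \<inter> X \<noteq> {}"
      by (rule same_cell_exposed[OF X hedge_in_H[OF t(2) xV] _ _ ne eq t(1,3)]) (auto simp: hedge_def)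
    moreover have "x \<in> hedge t x" by (simp add: hedge_def)
    ultimately show False using cell_edge[of "hedge t x" x] xX by auto
  qed
  then show thesis using that t inC by blast
qed

text \<open>If both vertices of an edge of \<open>M\<close> were good, that edge could be replaced by two edges, one at each of
its vertices, after the other four points of these have been freed. Thus every edge gets at most one
pivot.\<close>
lemma good_ends_unique:
  assumes X: "pivot_set X" and rob: "robust X c f" and f: "3 + 4 * (6 * c + 3) \<le> f"
    and B: "27 * (\<mu> + 1) < B"
    and x: "x \<in> good X B" and y: "y \<in> good X B" and cell: "cell x = cell y"
  shows "x = y"
proof (rule ccontr)
  assume xy: "x \<noteq> y"
  define e where "e = cell x"
  have eM: "e \<in> M" using x cell_in_M by (auto simp: e_def good_def)
  have xe: "x \<in> e" "y \<in> e" using in_cell[of x] in_cell[of y] cell by (simp_all add: e_def)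
  have xV: "x \<in> V" "y \<in> V" using x y by (auto simp: good_def)
  have ce: "card e = 3" "finite e" using eM M_H card_hedge finite_hedge by auto
  obtain t where t: "t \<in> S" "t \<in> exposed X" "\<pi> t x \<in> exposed X" "cell t \<inter> e = {}" "cell (\<pi> t x) \<inter> e = {}"
    "cell t \<noteq> cell (\<pi> t x)"
    using good_choice[OF X x, of e] ce B by auto
  define u where "u = \<pi> t x"
  let ?F = "e \<union> cell t \<union> cell u"
  have "card ?F \<le> 9"
    using card_Un_le[of "e \<union> cell t" "cell u"] card_Un_le[of e "cell t"] card_cell[of t] card_cell[of u] ce by linarith
  then have "3 * card ?F * (\<mu> + 1) \<le> 27 * (\<mu> + 1)" by (intro mult_le_mono1) simp
  then have "3 * card ?F * (\<mu> + 1) < B" using B by linarith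
  then obtain t' where t': "t' \<in> S" "t' \<in> exposed X" "\<pi> t' y \<in> exposed X" "cell t' \<inter> ?F = {}"
    "cell (\<pi> t' y) \<inter> ?F = {}" "cell t' \<noteq> cell (\<pi> t' y)"
    using good_choice[OF X y, of ?F] ce finite_cell by (metis finite_Un)
  define u' where "u' = \<pi> t' y"
  let ?W = "{t, u, t', u'}"
  have ne: "cell t \<noteq> cell t'" "cell t \<noteq> cell u'" "cell u \<noteq> cell t'" "cell u \<noteq> cell u'"
    "cell t \<noteq> cell u" "cell t' \<noteq> cell u'"
    using t(6) t'(4,5,6) in_cell[of t'] in_cell[of u'] unfolding u_def u'_def by blast+
  then have inj: "inj_on cell ?W" by (auto simp: inj_on_def)
  have card4: "card ?W = 4" using ne by (auto simp: card_insert_if)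
  have "?W \<subseteq> exposed X" using t t' by (auto simp: u_def u'_def)
  moreover have "card e + card ?W * (6 * c + 3) \<le> f" using f ce card4 by simp
  moreover have "\<forall>w\<in>?W. cell w \<inter> e = {}" using t t' by (auto simp: u_def u'_def)
  ultimately obtain D A where s: "switch D A" "footprint D A \<inter> e = {}" "?W \<subseteq> freed D A"
    using robust_simultaneous[OF rob _ _ inj, of e] ce by auto
  note sw = switchD[OF s(1)]
  have h: "hedge t x = {x, u, t}" "hedge t' y = {y, u', t'}" by (auto simp: hedge_def u_def u'_def)
  have hH: "hedge t x \<in> H" "hedge t' y \<in> H" using t t' xV hedge_in_H by auto
  have notin: "t \<notin> e" "u \<notin> e" "t' \<notin> e" "u' \<notin> e"
    using t t' in_cell[of t] in_cell[of u] in_cell[of t'] in_cell[of u'] unfolding u_def u'_def by blast+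
  have dis1: "\<Union>{hedge t x} \<inter> \<Union>{hedge t' y} = {}" using notin xe xy ne by (auto simp: h)
  have xA: "x \<notin> \<Union>A" "y \<notin> \<Union>A" using s(2) xe by (auto simp: footprint_def)
  have dis2: "\<Union>A \<inter> \<Union>({hedge t x} \<union> {hedge t' y}) = {}"
    using s(3) xA by (auto simp: h freed_def)
  have "{hedge t x} \<inter> {hedge t' y} = {}" using hH by (intro H_family_disjoint[OF _ dis1]) auto
  then have "card ({hedge t x} \<union> {hedge t' y}) = 2" by auto
  moreover have "A \<inter> ({hedge t x} \<union> {hedge t' y}) = {}" by (rule H_family_disjoint[OF sw(2) dis2])
  ultimately have "card (A \<union> ({hedge t x} \<union> {hedge t' y})) = card D + 2"
    using sw by (subst card_Un_disjoint) auto
  moreover have "card (A \<union> ({hedge t x} \<union> {hedge t' y})) \<le> card (insert e D)"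
  proof (rule exchange_bound)
    have "disjoint ({hedge t x} \<union> {hedge t' y})" using dis1 by (intro disjoint_Un) auto
    then show "disjoint (A \<union> ({hedge t x} \<union> {hedge t' y}))" using disjoint_Un[OF sw(3) _ dis2] by blast
    show "\<Union>(A \<union> ({hedge t x} \<union> {hedge t' y})) \<subseteq> \<Union>(insert e D) \<union> free"
      using sw(5) s(3) xe by (auto simp: freed_def h)
  qed (use sw eM hH in auto)
  moreover have "card (insert e D) \<le> Suc (card D)" using sw by (simp add: card_insert_if)
  ultimately show False by simp
qed

text \<open>To free a point next to a new pivot \<open>x\<close>, free an exposed slot \<open>t\<close> and the exposed vertex \<open>\<pi> t x\<close>, and
then move \<open>x\<close> from its old edge to \<open>hedge t x\<close>. Two switches and one exchange give the size
\<open>2 * c + 1\<close>.\<close>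
lemma robust_step:
  assumes X: "pivot_set X" and rob: "robust X c f" and f: "f' + 3 + 2 * (6 * c + 3) \<le> f"
    and B: "3 * (f' + 3) * (\<mu> + 1) < B"
  shows "robust (X \<union> good X B) (2 * c + 1) f'"
  unfolding robust_def
proof (intro ballI allI impI)
  fix z F assume z: "z \<in> exposed (X \<union> good X B)" and "finite F \<and> card F \<le> f' \<and> cell z \<inter> F = {}"
  then have F: "finite F" "card F \<le> f'" "cell z \<inter> F = {}" by auto
  show "\<exists>D A. switch D A \<and> card D \<le> 2 * c + 1 \<and> footprint D A \<inter> F = {} \<and> z \<in> freed D A"
  proof (cases "z \<in> exposed X")
    case True
    have "card F \<le> f" using F f by simp
    then obtain D A where "switch D A" "card D \<le> c" "footprint D A \<inter> F = {}" "z \<in> freed D A"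
      using robustD[OF rob True F(1) _ F(3)] by blast
    moreover have "c \<le> 2 * c + 1" by simp
    ultimately show ?thesis using le_trans by blast
  next
    case False
    then obtain x where x: "x \<in> good X B" "z \<in> cell x" "z \<noteq> x" using z by (auto simp: exposed_def)
    define e where "e = cell x"
    have eM: "e \<in> M" using x cell_in_M by (auto simp: e_def good_def)
    have xe: "x \<in> e" "z \<in> e" using in_cell[of x] x by (simp_all add: e_def)
    have eF: "e \<inter> F = {}" using F(3) cell_eq[OF x(2)] by (simp add: e_def)
    have xV: "x \<in> V" using x by (auto simp: good_def)
    have ce: "card e = 3" "finite e" using eM M_H card_hedge finite_hedge by auto
    have cFe: "card (F \<union> e) \<le> f' + 3" using card_Un_le[of F e] ce F by linarith
    then have "3 * card (F \<union> e) * (\<mu> + 1) \<le> 3 * (f' + 3) * (\<mu> + 1)" by (intro mult_le_mono1) simp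
    then have "3 * card (F \<union> e) * (\<mu> + 1) < B" using B by linarith
    moreover have "finite (F \<union> e)" using F ce by simp
    ultimately obtain t where t: "t \<in> S" "t \<in> exposed X" "\<pi> t x \<in> exposed X" "cell t \<inter> (F \<union> e) = {}"
      "cell (\<pi> t x) \<inter> (F \<union> e) = {}" "cell t \<noteq> cell (\<pi> t x)"
      using good_choice[OF X x(1)] by metis
    define u where "u = \<pi> t x"
    have inj: "inj_on cell {t, u}" using t(6) by (auto simp: u_def)
    have "t \<noteq> u" using t(6) unfolding u_def by metis
    then have c2: "card {t, u} = 2" by simp
    have "{t, u} \<subseteq> exposed X" using t by (auto simp: u_def)
    moreover have "card (F \<union> e) + card {t, u} * (6 * c + 3) \<le> f" using f cFe c2 by simp
    moreover have "\<forall>w\<in>{t, u}. cell w \<inter> (F \<union> e) = {}" using t by (auto simp: u_def)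
    ultimately obtain D A where s: "switch D A" "card D \<le> 2 * c" "footprint D A \<inter> (F \<union> e) = {}" "{t, u} \<subseteq> freed D A"
      using robust_simultaneous[OF rob _ _ inj, of "F \<union> e"] \<open>finite (F \<union> e)\<close> c2 by auto
    note sw = switchD[OF s(1)]
    have h: "hedge t x = {x, u, t}" by (auto simp: hedge_def u_def)
    have hH: "hedge t x \<in> H" using t xV hedge_in_H by auto
    have notin: "t \<notin> F \<union> e" "u \<notin> F \<union> e"
      using t in_cell[of t] in_cell[of u] unfolding u_def by blast+
    have xA: "x \<notin> \<Union>A" "z \<notin> \<Union>A" using s(3) xe by (auto simp: footprint_def)
    have dis: "\<Union>A \<inter> \<Union>{hedge t x} = {}" using s(4) xA by (auto simp: h freed_def)
    have "A \<inter> {hedge t x} = {}" by (rule H_family_disjoint[OF sw(2) dis])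
    then have cA: "card (A \<union> {hedge t x}) = Suc (card D)" using sw by simp
    have "e \<notin> D" using s(3) xe by (auto simp: footprint_def)
    then have cD: "card (insert e D) = Suc (card D)" using sw by simp
    have "switch (insert e D) (A \<union> {hedge t x})"
      unfolding switch_def
    proof (intro conjI)
      show "disjoint (A \<union> {hedge t x})" using sw(3) dis by (intro disjoint_Un) auto
      show "\<Union>(A \<union> {hedge t x}) \<subseteq> \<Union>(insert e D) \<union> free"
        using sw(5) s(4) xe by (auto simp: freed_def h)
    qed (use sw eM hH cA cD in auto)
    moreover have "card (insert e D) \<le> 2 * c + 1" using cD s(2) by simp
    moreover have "footprint (insert e D) (A \<union> {hedge t x}) \<inter> F = {}"
      using s(3) eF notin xe by (auto simp: footprint_def h)
    moreover have "z \<in> freed (insert e D) (A \<union> {hedge t x})"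
      using xe xA notin x(3) by (auto simp: freed_def h)
    ultimately show ?thesis by blast
  qed
qed

text \<open>Each pivot exposes one further vertex, namely the other vertex of its edge.\<close>
lemma card_exposed_vertices:
  assumes X: "pivot_set X"
  shows "card (free \<inter> V) + card X \<le> card (exposed X \<inter> V)"
proof -
  have XV: "X \<subseteq> V" and XM: "X \<subseteq> \<Union>M" and inj: "inj_on cell X" using X by (auto simp: pivot_set_def)
  have "\<forall>x\<in>X. \<exists>y. y \<in> cell x \<and> y \<noteq> x \<and> y \<in> V"
  proof
    fix x assume x: "x \<in> X"
    then have "cell x \<in> H" using cell_in_M XM M_H by blast
    then have "card (V \<inter> cell x) = 2" by (rule hedge_vertices)
    then have "\<not> V \<inter> cell x \<subseteq> {x}" using card_mono[of "{x}" "V \<inter> cell x"] by auto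
    then show "\<exists>y. y \<in> cell x \<and> y \<noteq> x \<and> y \<in> V" by blast
  qed
  then obtain m where m: "\<And>x. x \<in> X \<Longrightarrow> m x \<in> cell x \<and> m x \<noteq> x \<and> m x \<in> V"
    using bchoice[of X "\<lambda>x y. y \<in> cell x \<and> y \<noteq> x \<and> y \<in> V"] by blast
  have "inj_on m X"
  proof (rule inj_onI)
    fix x y assume xy: "x \<in> X" "y \<in> X" "m x = m y"
    then have "cell x = cell y" using m cell_eq[of "m x" x] cell_eq[of "m y" y] by metis
    then show "x = y" using inj xy by (auto dest: inj_onD)
  qed
  then have "card (m ` X) = card X" by (rule card_image)
  moreover have "(free \<inter> V) \<inter> m ` X = {}"
  proof -
    have "m x \<in> \<Union>M" if "x \<in> X" for x using m[OF that] cell_in_M XM that by blast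
    then show ?thesis by (auto simp: free_def)
  qed
  moreover have "finite X" "finite (free \<inter> V)" using XV finite_V finite_subset by auto
  ultimately have "card (free \<inter> V) + card X = card ((free \<inter> V) \<union> m ` X)"
    by (simp add: card_Un_disjoint)
  also have "\<dots> \<le> card (exposed X \<inter> V)"
    using m finite_V by (intro card_mono) (auto simp: exposed_def)
  finally show ?thesis .
qed

text \<open>Double counting of the pairs of an exposed slot \<open>t\<close> and an exposed vertex \<open>u\<close>. The partner of \<open>u\<close> in
\<open>t\<close> is not exposed, hence is a pivot or lies in an edge without pivot. Pivots can absorb only \<open>card X\<close>
of the exposed vertices, so for every \<open>t\<close> at least as many partners as there are uncovered
vertices lie in edges without pivot. There, a vertex is either good or receives fewer than \<open>B\<close> pairs.\<close>
lemma good_count: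
  assumes X: "pivot_set X" and none: "\<And>h. h \<in> H \<Longrightarrow> \<not> h \<subseteq> exposed X"
  shows "card (free \<inter> V) * card (exposed X \<inter> S) \<le> card (good X B) * card (exposed X \<inter> S) + card V * B"
proof -
  define T U R where "T = exposed X \<inter> S" and "U = exposed X \<inter> V"
    and "R = {x \<in> V \<inter> \<Union>M. cell x \<inter> X = {}}"
  have XV: "X \<subseteq> V" using X by (auto simp: pivot_set_def)
  have fin: "finite T" "finite U" "finite R" "finite X"
    using finite_V finite_S XV finite_subset by (auto simp: T_def U_def R_def)
  have each: "card (free \<inter> V) \<le> card {x \<in> R. \<pi> t x \<in> U}" if t: "t \<in> T" for t
  proof -
    have tS: "t \<in> S" "t \<in> exposed X" using t by (auto simp: T_def)
    have inj: "inj_on (\<pi> t) U" using partner_partner[OF tS(1)] by (intro inj_onI) (metis IntD2 U_def)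
    have "\<pi> t ` U \<subseteq> X \<union> {x \<in> R. \<pi> t x \<in> U}"
    proof
      fix v assume "v \<in> \<pi> t ` U"
      then obtain u where u: "u \<in> U" "v = \<pi> t u" by blast
      have uV: "u \<in> V" "u \<in> exposed X" using u by (auto simp: U_def)
      have vV: "v \<in> V" using u uV partner_in tS by simp
      have "\<not> hedge t u \<subseteq> exposed X" using none hedge_in_H tS uV by blast
      then have vex: "v \<notin> exposed X" using u uV tS by (auto simp: hedge_def)
      then have vM: "v \<in> \<Union>M" using vV by (auto simp: exposed_def free_def)
      show "v \<in> X \<union> {x \<in> R. \<pi> t x \<in> U}"
      proof (cases "cell v \<inter> X = {}")
        case True
        then show ?thesis using vV vM u partner_partner tS uV by (simp add: R_def)
      next
        case False
        then obtain x where x: "x \<in> cell v" "x \<in> X" by blast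
        have "v \<in> cell x" using cell_eq[OF x(1)] in_cell[of v] by simp
        then have "v = x" using vex x(2) by (auto simp: exposed_def)
        then show ?thesis using x by simp
      qed
    qed
    then have "card (\<pi> t ` U) \<le> card (X \<union> {x \<in> R. \<pi> t x \<in> U})" using fin by (intro card_mono) auto
    then have "card U \<le> card X + card {x \<in> R. \<pi> t x \<in> U}"
      using card_image[OF inj] card_Un_le[of X "{x \<in> R. \<pi> t x \<in> U}"] by linarith
    then show ?thesis using card_exposed_vertices[OF X] by (simp add: U_def)
  qed
  have "card (free \<inter> V) * card T = (\<Sum>t\<in>T. card (free \<inter> V))" by simp
  also have "\<dots> \<le> (\<Sum>t\<in>T. card {x \<in> R. \<pi> t x \<in> U})" using each by (intro sum_mono)
  also have "\<dots> = (\<Sum>t\<in>T. \<Sum>x\<in>R. if \<pi> t x \<in> U then 1 else 0)"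
    using fin by (intro sum.cong) (simp_all add: sum.If_cases Int_def conj_commute)
  also have "\<dots> = (\<Sum>x\<in>R. \<Sum>t\<in>T. if \<pi> t x \<in> U then 1 else 0)" by (rule sum.swap)
  also have "\<dots> = (\<Sum>x\<in>R. card {t \<in> T. \<pi> t x \<in> U})"
    using fin by (intro sum.cong) (simp_all add: sum.If_cases Int_def conj_commute)
  also have "\<dots> \<le> (\<Sum>x\<in>R. (if x \<in> good X B then card T else 0) + B)"
  proof (rule sum_mono)
    fix x assume x: "x \<in> R"
    have eq: "{t \<in> T. \<pi> t x \<in> U} = {t \<in> exposed X \<inter> S. \<pi> t x \<in> exposed X}"
      using x partner_in by (auto simp: T_def U_def R_def)
    show "card {t \<in> T. \<pi> t x \<in> U} \<le> (if x \<in> good X B then card T else 0) + B"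
    proof (cases "x \<in> good X B")
      case True
      have "card {t \<in> T. \<pi> t x \<in> U} \<le> card T" using fin by (intro card_mono) auto
      then show ?thesis using True by simp
    next
      case False
      then have "\<not> B \<le> card {t \<in> T. \<pi> t x \<in> U}" using x unfolding eq by (auto simp: good_def R_def)
      then show ?thesis by simp
    qed
  qed
  also have "\<dots> = (\<Sum>x\<in>R. if x \<in> good X B then card T else 0) + card R * B"
    by (simp add: sum.distrib)
  also have "(\<Sum>x\<in>R. if x \<in> good X B then card T else 0) = card (R \<inter> good X B) * card T"
    using fin by (simp add: sum.If_cases Int_def)
  also have "R \<inter> good X B = good X B" by (auto simp: R_def good_def)
  also have "card R * B \<le> card V * B" using finite_V by (intro mult_le_mono1 card_mono) (auto simp: R_def)
  finally show ?thesis by (simp add: T_def)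
qed

text \<open>If too many slots were missing, one could go on adding pivots: every level adds \<open>m\<close> of them. The switch
sizes satisfy \<open>c (j + 1) = 2 * c j + 1\<close>, hence \<open>c j = 2 ^ j - 1\<close>. The number of avoidable points decreases
with the level, from less than \<open>36 * 2 ^ J\<close>, by \<open>12 * 2 ^ j\<close> at level \<open>j\<close>; this covers the points
that the two switches of a step have to avoid in addition. The bound on \<open>B\<close> lets
\<open>good_choice\<close> avoid nine points more than that.\<close>
lemma pivot_levels:
  assumes B: "3 * (36 * 2 ^ J + 9) * (\<mu> + 1) < B"
    and q: "2 * m \<le> card (free \<inter> V)" and \<tau>: "card V * B < m * card (free \<inter> S)"
    and j: "j \<le> J"
  shows "\<exists>X. pivot_set X \<and> robust X (2 ^ j - 1) (12 * (3 * 2 ^ J - 2 ^ j)) \<and> j * m \<le> card X"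
  using j
proof (induction j)
  case 0
  have "pivot_set {} \<and> robust {} (2 ^ 0 - 1) (12 * (3 * 2 ^ J - 2 ^ 0)) \<and> 0 * m \<le> card ({} :: 'a set)"
    using robust_empty by (simp add: pivot_set_def)
  then show ?case by blast
next
  case (Suc j)
  then obtain X where X: "pivot_set X" and rob: "robust X (2 ^ j - 1) (12 * (3 * 2 ^ J - 2 ^ j))"
    and cX: "j * m \<le> card X" by auto
  let ?c = "2 ^ j - 1 :: nat" and ?f = "12 * (3 * 2 ^ J - 2 ^ j) :: nat" and ?f' = "12 * (3 * 2 ^ J - 2 ^ Suc j) :: nat"
  define P Q :: nat where "P = 2 ^ j" and "Q = 2 ^ J"
  have P1: "1 \<le> P" by (simp add: P_def)
  have "(2::nat) ^ Suc j \<le> 2 ^ J" using Suc.prems by (intro power_increasing) auto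
  then have PQ: "2 * P \<le> Q" by (simp add: P_def Q_def)
  have f3: "3 * (6 * ?c + 3) \<le> ?f" and f4: "3 + 4 * (6 * ?c + 3) \<le> ?f"
    and fs: "?f' + 3 + 2 * (6 * ?c + 3) \<le> ?f" and fB: "3 * (?f' + 3) \<le> 3 * (36 * 2 ^ J + 9)"
  proof -
    obtain p q where "P = Suc p" "Q = 2 * P + q" using P1 PQ by (metis le_Suc_ex plus_1_eq_Suc)
    then show "3 * (6 * ?c + 3) \<le> ?f" "3 + 4 * (6 * ?c + 3) \<le> ?f"
      "?f' + 3 + 2 * (6 * ?c + 3) \<le> ?f" "3 * (?f' + 3) \<le> 3 * (36 * 2 ^ J + 9)"
      unfolding power_Suc P_def[symmetric] Q_def[symmetric] by simp_all
  qed
  have B': "3 * (?f' + 3) * (\<mu> + 1) < B" using mult_le_mono1[OF fB, of "\<mu> + 1"] B by linarith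
  have B27: "27 * (\<mu> + 1) < B"
  proof -
    have "27 * (\<mu> + 1) \<le> 3 * (36 * 2 ^ J + 9) * (\<mu> + 1)" by (intro mult_le_mono1) simp
    then show ?thesis using B by linarith
  qed
  let ?X = "X \<union> good X B"
  have finX: "finite X" "finite (good X B)"
    using X finite_V finite_subset by (auto simp: pivot_set_def good_def)
  have dis: "X \<inter> good X B = {}" using in_cell by (auto simp: good_def)
  have "pivot_set ?X" unfolding pivot_set_def
  proof
    show "?X \<subseteq> V \<inter> \<Union>M" using X by (auto simp: pivot_set_def good_def)
    show "inj_on cell ?X"
    proof (rule inj_onI)
      fix x y assume xy: "x \<in> ?X" "y \<in> ?X" "cell x = cell y"
      have *: "False" if "a \<in> X" "b \<in> good X B" "cell a = cell b" for a b
        using that in_cell[of a] by (auto simp: good_def)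
      consider "x \<in> X" "y \<in> X" | "x \<in> good X B" "y \<in> good X B" using xy * by fastforce
      then show "x = y"
      proof cases
        case 1
        then show ?thesis using X xy(3) by (auto simp: pivot_set_def dest: inj_onD)
      next
        case 2
        then show ?thesis using good_ends_unique[OF X rob f4 B27] xy(3) by blast
      qed
    qed
  qed
  moreover have "robust ?X (2 ^ Suc j - 1) ?f'"
  proof -
    have "2 * ?c + 1 = 2 ^ Suc j - 1" using P1 unfolding power_Suc P_def[symmetric] by arith
    then show ?thesis using robust_step[OF X rob fs B'] by metis
  qed
  moreover have "Suc j * m \<le> card ?X"
  proof -
    have "m \<le> card (good X B)"
    proof (rule ccontr)
      assume neg: "\<not> ?thesis"
      let ?T = "card (exposed X \<inter> S)"
      have "card (free \<inter> V) * ?T \<le> card (good X B) * ?T + card V * B"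
        using good_count[OF X] no_exposed_hedge[OF X rob f3] by blast
      moreover have "(card (good X B) + m) * ?T \<le> card (free \<inter> V) * ?T"
        using neg q by (intro mult_le_mono1) simp
      ultimately have "m * ?T \<le> card V * B" by (simp add: add_mult_distrib)
      moreover have "m * card (free \<inter> S) \<le> m * ?T"
        using finite_S by (intro mult_le_mono2 card_mono) (auto simp: exposed_def)
      ultimately show False using \<tau> by linarith
    qed
    then show ?thesis using cX finX dis by (simp add: card_Un_disjoint)
  qed
  ultimately show ?case by blast
qed

end

text \<open>After \<open>J\<close> levels there would be more pivots than vertices. So the number of slots missed by a maximum
matching is at most of the order of the codegree \<open>\<mu>\<close>, if the number of slots stays below half
the number of vertices by a fixed proportion.\<close>
lemma (in slot_hypergraph) matching_missing_few_slots:
  assumes slots: "2 * card S + 2 * m \<le> card V" and J: "card V < J * m"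
  obtains M where "M \<subseteq> H" "disjoint M" "m * (card S - card M) \<le> card V * (136 * 2 ^ J * (\<mu> + 1))"
proof -
  let ?F = "{M. M \<subseteq> H \<and> disjoint M}"
  have fin: "finite ?F" using finite_H by (auto intro: finite_subset[of _ "Pow H"])
  moreover have "{} \<in> ?F" by simp
  ultimately have "Max (card ` ?F) \<in> card ` ?F" by (intro Max_in) blast+
  then obtain M where M: "M \<in> ?F" "Max (card ` ?F) = card M" by blast
  have max: "card M' \<le> card M" if "M' \<in> ?F" for M'
    using fin that unfolding M(2)[symmetric] by (intro Max_ge) blast+
  interpret maximum_slot_matching V S \<pi> \<mu> M
    using M max by unfold_locales auto
  have dis: "disjoint_family_on (\<lambda>e. A \<inter> e) M" for A
    using M_unique unfolding disjoint_family_on_def by blast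
  have "card (S \<inter> \<Union>M) = (\<Sum>e\<in>M. card (S \<inter> e))"
    unfolding Int_Union using dis[of S] finite_M finite_S
    by (intro card_UN_disjoint) (auto simp: disjoint_family_on_def)
  also have "\<dots> = (\<Sum>e\<in>M. 1)" using hedge_slots M_H by (intro sum.cong) auto
  finally have cS: "card (S \<inter> \<Union>M) = card M" by simp
  have "card (V \<inter> \<Union>M) = (\<Sum>e\<in>M. card (V \<inter> e))"
    unfolding Int_Union using dis[of V] finite_M finite_V
    by (intro card_UN_disjoint) (auto simp: disjoint_family_on_def)
  also have "\<dots> = (\<Sum>e\<in>M. 2)" using hedge_vertices M_H by (intro sum.cong) auto
  finally have cV: "card (V \<inter> \<Union>M) = 2 * card M" by simp
  have "free \<inter> S = S - S \<inter> \<Union>M" "free \<inter> V = V - V \<inter> \<Union>M" by (auto simp: free_def)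
  then have fS: "card (free \<inter> S) = card S - card M" and fV: "card (free \<inter> V) = card V - 2 * card M"
    using cS cV finite_S finite_V by (simp_all add: card_Diff_subset)
  have "card M \<le> card S" using cS card_mono[of S "S \<inter> \<Union>M"] finite_S by simp
  then have q: "2 * m \<le> card (free \<inter> V)" using slots fV by simp
  define B where "B = 136 * 2 ^ J * (\<mu> + 1)"
  have "m * card (free \<inter> S) \<le> card V * B"
  proof (rule ccontr)
    assume "\<not> ?thesis"
    then have \<tau>: "card V * B < m * card (free \<inter> S)" by simp
    have "3 * (36 * 2 ^ J + 9) < 136 * (2::nat) ^ J"
    proof -
      have "3 * (36 * x + 9) < 136 * x" if "1 \<le> x" for x :: nat using that by arith
      from this[of "2 ^ J"] show ?thesis by simp
    qed
    then have "3 * (36 * 2 ^ J + 9) * (\<mu> + 1) < B" unfolding B_def by (intro mult_strict_right_mono) simp_all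
    then obtain X where "pivot_set X" "J * m \<le> card X" using pivot_levels[OF _ q \<tau>, of J J] by auto
    moreover have "card X \<le> card V" if "pivot_set X" for X
      using that finite_V by (intro card_mono) (auto simp: pivot_set_def)
    ultimately show False using J by (meson leD le_trans)
  qed
  then show thesis using that[OF M_H M_disjoint] fS by (simp add: B_def)
qed

section \<open>Coloured perfect matchings\<close>

lemma family_index_unique:
  assumes "disjoint_family_on N I" "i \<in> I" "j \<in> I" "x \<in> N i" "x \<in> N j"
  shows "i = j"
proof (rule ccontr)
  assume "i \<noteq> j"
  then have "N i \<inter> N j = {}" using assms(1-3) by (simp add: disjoint_family_on_def)
  then show False using assms(4,5) by blast
qed

lemma perfect_matching_facts:
  assumes "is_perfect_matching (2 * n) N"
  shows "finite N" "disjoint N" "\<forall>e\<in>N. card e = 2" "card N = n" "N \<subseteq> complete_edges (2 * n)"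
    "\<Union>N = {..<2 * n}"
proof -
  show N: "disjoint N" "\<forall>e\<in>N. card e = 2" "N \<subseteq> complete_edges (2 * n)" "\<Union>N = {..<2 * n}"
    using assms by (auto simp: is_perfect_matching_def is_matching_def complete_edges_def)
  then show "finite N" by (metis finite_UnionD finite_lessThan)
  have "card (\<Union>N) = (\<Sum>e\<in>N. card e)"
    using N by (intro card_Union_disjoint) (auto intro: card_ge_0_finite)
  then show "card N = n" using N by simp
qed

lemma card_edges_meeting:
  assumes "disjoint N" "finite U"
  shows "card {e \<in> N. e \<inter> U \<noteq> {}} \<le> card U"
proof -
  have "\<forall>e\<in>{e \<in> N. e \<inter> U \<noteq> {}}. \<exists>x. x \<in> e \<inter> U" by blast
  from bchoice[OF this] obtain p where "\<forall>e\<in>{e \<in> N. e \<inter> U \<noteq> {}}. p e \<in> e \<inter> U" ..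
  then have p: "p e \<in> e \<inter> U" if "e \<in> {e \<in> N. e \<inter> U \<noteq> {}}" for e using that by simp
  have "inj_on p {e \<in> N. e \<inter> U \<noteq> {}}"
  proof (rule inj_onI)
    fix e f assume e: "e \<in> {e \<in> N. e \<inter> U \<noteq> {}}" and f: "f \<in> {e \<in> N. e \<inter> U \<noteq> {}}" and eq: "p e = p f"
    have "\<not> disjnt e f" using p[OF e] p[OF f] eq by (auto simp: disjnt_def)
    then show "e = f" using assms(1) e f by (auto simp: pairwise_def)
  qed
  then show ?thesis using p assms(2) by (intro card_inj_on_le[of p]) auto
qed

text \<open>A maximal matching that overfulfils no demand fulfils all of them: its edges meet at most
\<open>2 * card S\<close> edges of each class.\<close>
lemma greedy_matching:
  assumes fin: "finite I"
    and N: "\<And>i. i \<in> I \<Longrightarrow> finite (N i) \<and> disjoint (N i) \<and> (\<forall>e\<in>N i. card e = 2)"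
    and Ndisj: "disjoint_family_on N I"
    and room: "\<And>i. i \<in> I \<Longrightarrow> 2 * (\<Sum>j\<in>I. a j) \<le> card (N i)"
  obtains S where "S \<subseteq> (\<Union>i\<in>I. N i)" "disjoint S" "\<And>i. i \<in> I \<Longrightarrow> card (S \<inter> N i) = a i"
proof -
  let ?F = "{S. S \<subseteq> (\<Union>i\<in>I. N i) \<and> disjoint S \<and> (\<forall>i\<in>I. card (S \<inter> N i) \<le> a i)}"
  have finU: "finite (\<Union>i\<in>I. N i)" using fin N by auto
  have finF: "finite ?F" by (rule finite_subset[of _ "Pow (\<Union>i\<in>I. N i)"]) (use finU in auto)
  moreover have "{} \<in> ?F" by simp
  ultimately have "Max (card ` ?F) \<in> card ` ?F" by (intro Max_in) blast+
  then obtain S where S: "S \<in> ?F" "Max (card ` ?F) = card S" by blast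
  have max: "card S' \<le> card S" if "S' \<in> ?F" for S'
    using finF that unfolding S(2)[symmetric] by (intro Max_ge) blast+
  have SU: "S \<subseteq> (\<Union>i\<in>I. N i)" and Sd: "disjoint S" and Sle: "\<And>i. i \<in> I \<Longrightarrow> card (S \<inter> N i) \<le> a i"
    using S(1) by auto
  have finS: "finite S" using SU finU finite_subset by blast
  have S2: "card e = 2" if "e \<in> S" for e using that SU N by blast
  have Sfin: "finite e" if "e \<in> S" for e using S2[OF that] card_ge_0_finite[of e] by simp
  have "card (S \<inter> N i) = a i" if i: "i \<in> I" for i
  proof (rule ccontr)
    assume "\<not> ?thesis"
    then have less: "card (S \<inter> N i) < a i" using Sle[OF i] by simp
    have "card S = (\<Sum>j\<in>I. card (S \<inter> N j))" using card_eq_sum_classes[OF fin finS Ndisj SU] .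
    also have "\<dots> < (\<Sum>j\<in>I. a j)" using less i Sle fin by (intro sum_strict_mono_ex1) auto
    finally have "2 * card S < card (N i)" using room[OF i] by linarith
    moreover have finUS: "finite (\<Union>S)" using finS Sfin by blast
    moreover have "card (\<Union>S) \<le> (\<Sum>e\<in>S. card e)"
      using Sfin by (intro card_Union_le_sum_card)
    moreover have "(\<Sum>e\<in>S. card e) = 2 * card S" using S2 by simp
    moreover have "card {e \<in> N i. e \<inter> \<Union>S \<noteq> {}} \<le> card (\<Union>S)"
      by (rule card_edges_meeting) (use N[OF i] finUS in blast)+
    ultimately have few: "card {e \<in> N i. e \<inter> \<Union>S \<noteq> {}} < card (N i)" by linarith
    obtain e where e: "e \<in> N i" "e \<inter> \<Union>S = {}"
    proof (rule ccontr)
      assume none: "\<not> thesis"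
      have "{e \<in> N i. e \<inter> \<Union>S \<noteq> {}} = N i"
      proof (intro equalityI subsetI)
        fix e assume "e \<in> N i"
        then show "e \<in> {e \<in> N i. e \<inter> \<Union>S \<noteq> {}}" using none that[of e] by simp metis
      qed simp
      then show False using few by simp
    qed
    have "e \<noteq> {}" using e N[OF i] by auto
    then have eS: "e \<notin> S" using e(2) by blast
    have "insert e S \<in> ?F"
    proof (intro CollectI conjI ballI)
      show "insert e S \<subseteq> (\<Union>i\<in>I. N i)" using e i SU by blast
      show "disjoint (insert e S)" using disjoint_Un[of "{e}" S] e(2) Sd by auto
      fix j assume j: "j \<in> I"
      show "card (insert e S \<inter> N j) \<le> a j"
      proof (cases "j = i")
        case True
        have "card (insert e S \<inter> N j) \<le> Suc (card (S \<inter> N i))"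
          using True finS e by (simp add: Int_insert_left card_insert_if)
        then show ?thesis using less True by simp
      next
        case False
        then have "e \<notin> N j" using family_index_unique[OF Ndisj j i _ e(1)] by blast
        then show ?thesis using Sle[OF j] by simp
      qed
    qed
    from max[OF this] show False using eS finS by simp
  qed
  then show thesis using that SU Sd by blast
qed

definition mate :: "'a set set \<Rightarrow> 'a \<Rightarrow> 'a" where
  "mate N v = (THE w. {v, w} \<in> N)"

lemma mate_eqI:
  assumes "disjoint N" "{v, w} \<in> N"
  shows "mate N v = w"
  unfolding mate_def
proof (rule the_equality)
  fix w' assume "{v, w'} \<in> N"
  moreover have "\<not> disjnt {v, w'} {v, w}" by (simp add: disjnt_def)
  ultimately have "{v, w'} = {v, w}" using assms by (metis pairwiseD)
  then show "w' = w" by (auto simp: doubleton_eq_iff)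
qed (fact assms)

lemma mate_edge:
  assumes N: "is_perfect_matching (2 * n) N" and v: "v < 2 * n"
  shows "{v, mate N v} \<in> N" "mate N v \<noteq> v" "mate N v < 2 * n" "mate N (mate N v) = v"
proof -
  note P = perfect_matching_facts[OF N]
  obtain e where e: "e \<in> N" "v \<in> e" using P(6) v by blast
  then have "card e = 2" using P(3) by blast
  then obtain w where w: "e = {v, w}" "w \<noteq> v" using e(2) by (auto simp: card_2_iff)
  have m: "mate N v = w" using mate_eqI[OF P(2)] e w by blast
  show "{v, mate N v} \<in> N" "mate N v \<noteq> v" using m e w by auto
  have "w \<in> \<Union>N" using e w by blast
  then show "mate N v < 2 * n" using P(6) m by simp
  have "{w, v} \<in> N" using e w by (simp add: insert_commute)
  then show "mate N (mate N v) = v" using mate_eqI[OF P(2)] m by simp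
qed

text \<open>The slot bound for coloured graphs. The point \<open>Inl v\<close> is the vertex \<open>v\<close>, and \<open>Inr (i, j)\<close> is the \<open>j\<close>-th slot of
the colour \<open>i\<close>. Since the perfect matchings share no edge, two vertices are joined in one colour only,
and the codegree is at most the largest demand.\<close>
lemma nearly_full_matching:
  fixes N :: "nat \<Rightarrow> nat set set" and b :: "nat \<Rightarrow> nat"
  assumes fin: "finite I" and N: "\<And>i. i \<in> I \<Longrightarrow> is_perfect_matching (2 * n) (N i)"
    and Ndisj: "disjoint_family_on N I" and \<mu>: "\<And>i. i \<in> I \<Longrightarrow> b i \<le> \<mu>"
    and total: "(\<Sum>i\<in>I. b i) + m \<le> n" and J: "2 * n < J * m"
  obtains M where "M \<subseteq> (\<Union>i\<in>I. N i)" "disjoint M" "\<And>i. i \<in> I \<Longrightarrow> card (M \<inter> N i) \<le> b i"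
    "(\<Sum>i\<in>I. b i - card (M \<inter> N i)) \<le> J * (136 * 2 ^ J * (\<mu> + 1))"
proof -
  define V :: "(nat + nat \<times> nat) set" where "V = Inl ` {..<2 * n}"
  define S :: "(nat + nat \<times> nat) set" where "S = Inr ` (SIGMA i:I. {..<b i})"
  define \<pi> :: "nat + nat \<times> nat \<Rightarrow> nat + nat \<times> nat \<Rightarrow> nat + nat \<times> nat" where
    "\<pi> s v = Inl (mate (N (fst (projr s))) (projl v))" for s v
  have cS: "card S = (\<Sum>i\<in>I. b i)" using fin by (simp add: S_def card_image)
  have cV: "card V = 2 * n" by (simp add: V_def card_image)
  interpret slot_hypergraph V S \<pi> \<mu>
  proof
    show "finite V" "finite S" "V \<inter> S = {}" using fin by (auto simp: V_def S_def)
    fix s v assume "s \<in> S" "v \<in> V"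
    then obtain i j x where sv: "s = Inr (i, j)" "i \<in> I" "v = Inl x" "x < 2 * n" by (auto simp: S_def V_def)
    show "\<pi> s v \<in> V" "\<pi> s (\<pi> s v) = v" "\<pi> s v \<noteq> v"
      using mate_edge[OF N[OF sv(2)] sv(4)] sv by (auto simp: \<pi>_def V_def)
  next
    fix u v assume "u \<in> V" "v \<in> V"
    then obtain x y where xy: "u = Inl x" "v = Inl y" "x < 2 * n" by (auto simp: V_def)
    have edge: "{x, y} \<in> N i" if "Inr (i, j) \<in> S" "\<pi> (Inr (i, j)) u = v" for i j
      using that mate_edge(1)[of n "N i" x] N xy by (auto simp: S_def \<pi>_def)
    show "card {s \<in> S. \<pi> s u = v} \<le> \<mu>"
    proof (cases "\<exists>i\<in>I. {x, y} \<in> N i")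
      case True
      then obtain i where i: "i \<in> I" "{x, y} \<in> N i" by blast
      have "{s \<in> S. \<pi> s u = v} \<subseteq> Inr ` ({i} \<times> {..<b i})"
      proof
        fix s assume s: "s \<in> {s \<in> S. \<pi> s u = v}"
        then obtain i' j where ij: "s = Inr (i', j)" "i' \<in> I" "j < b i'" by (auto simp: S_def)
        then have "{x, y} \<in> N i'" using edge s by auto
        then have "i' = i" using family_index_unique[OF Ndisj] i ij(2) by metis
        then show "s \<in> Inr ` ({i} \<times> {..<b i})" using ij by auto
      qed
      then have "card {s \<in> S. \<pi> s u = v} \<le> card (Inr ` ({i} \<times> {..<b i}) :: (nat + nat \<times> nat) set)"
        by (intro card_mono) auto
      also have "\<dots> = b i" by (simp add: card_image card_cartesian_product)
      finally show ?thesis using \<mu>[OF i(1)] by simp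
    next
      case False
      then have "{s \<in> S. \<pi> s u = v} = {}" using edge by (auto simp: S_def)
      then show ?thesis by (simp only: card.empty le0)
    qed
  qed
  have "2 * card S + 2 * m \<le> card V" using total cS cV by simp
  moreover have "card V < J * m" using J cV by simp
  ultimately obtain Q where Q: "Q \<subseteq> H" "disjoint Q"
    and few: "m * (card S - card Q) \<le> card V * (136 * 2 ^ J * (\<mu> + 1))"
    using matching_missing_few_slots by blast
  have finQ: "finite Q" using Q finite_H finite_subset by blast
  define E :: "(nat + nat \<times> nat) set \<Rightarrow> nat set" where "E h = Inl -` h" for h
  have shape: "\<exists>i j. i \<in> I \<and> j < b i \<and> Inr (i, j) \<in> h \<and> E h \<in> N i" if h: "h \<in> Q" for h
  proof -
    obtain s v where sv: "s \<in> S" "v \<in> V" "h = hedge s v" using h Q(1) by (auto simp: H_def)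
    obtain i j x where ij: "s = Inr (i, j)" "i \<in> I" "j < b i" "v = Inl x" "x < 2 * n"
      using sv by (auto simp: S_def V_def)
    have "E h = {x, mate (N i) x}" using sv ij by (auto simp: E_def hedge_def \<pi>_def)
    then have "E h \<in> N i" using mate_edge(1)[OF N[OF ij(2)] ij(5)] by simp
    moreover have "Inr (i, j) \<in> h" using sv ij by (auto simp: hedge_def)
    ultimately show ?thesis using ij by blast
  qed
  have Edis: "E h \<inter> E h' = {}" if "h \<in> Q" "h' \<in> Q" "h \<noteq> h'" for h h'
  proof -
    have "h \<inter> h' = {}" using that Q(2) by (auto simp: pairwise_def disjnt_def)
    then show ?thesis by (auto simp: E_def)
  qed
  have Ene: "E h \<noteq> {}" if h: "h \<in> Q" for h
  proof -
    obtain i where "i \<in> I" "E h \<in> N i" using shape[OF h] by blast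
    then show ?thesis using perfect_matching_facts(3)[OF N[of i]] by auto
  qed
  have inj: "inj_on E Q"
  proof (rule inj_onI, rule ccontr)
    fix h h' assume "h \<in> Q" "h' \<in> Q" "E h = E h'" "h \<noteq> h'"
    then show False using Edis[of h h'] Ene[of h] by simp
  qed
  let ?M = "E ` Q"
  have MU: "?M \<subseteq> (\<Union>i\<in>I. N i)" using shape by blast
  have Md: "disjoint ?M" unfolding pairwise_def disjnt_def using Edis by blast
  have Mb: "card (?M \<inter> N i) \<le> b i" if i: "i \<in> I" for i
  proof -
    let ?Q = "{h \<in> Q. E h \<in> N i}"
    have "\<forall>h\<in>?Q. \<exists>j. j < b i \<and> Inr (i, j) \<in> h"
    proof
      fix h assume h: "h \<in> ?Q"
      then obtain i' j where ij: "i' \<in> I" "j < b i'" "Inr (i', j) \<in> h" "E h \<in> N i'" using shape by blast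
      then have "i' = i" using family_index_unique[OF Ndisj ij(1) i ij(4)] h by simp
      then show "\<exists>j. j < b i \<and> Inr (i, j) \<in> h" using ij by blast
    qed
    from bchoice[OF this] obtain f where "\<forall>h\<in>?Q. f h < b i \<and> Inr (i, f h) \<in> h" ..
    then have f: "f h < b i \<and> Inr (i, f h) \<in> h" if "h \<in> ?Q" for h using that by simp
    have "inj_on f ?Q"
    proof (rule inj_onI, rule ccontr)
      fix h h' assume h: "h \<in> ?Q" "h' \<in> ?Q" "f h = f h'" "h \<noteq> h'"
      then have "h \<inter> h' = {}" using Q(2) by (auto simp: pairwise_def disjnt_def)
      moreover have "Inr (i, f h) \<in> h" "Inr (i, f h) \<in> h'" using f[OF h(1)] f[OF h(2)] h(3) by auto
      ultimately show False by blast
    qed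
    then have "card ?Q \<le> card {..<b i}" using f by (intro card_inj_on_le[of f]) auto
    moreover have "?M \<inter> N i = E ` ?Q" by blast
    then have "card (?M \<inter> N i) \<le> card ?Q" using finQ by (simp add: card_image_le)
    ultimately show ?thesis by simp
  qed
  have "finite ?M" using finQ by simp
  then have "card Q = (\<Sum>i\<in>I. card (?M \<inter> N i))"
    using card_eq_sum_classes[OF fin _ Ndisj MU] card_image[OF inj] by simp
  moreover have "(\<Sum>i\<in>I. b i - card (?M \<inter> N i)) = (\<Sum>i\<in>I. b i) - (\<Sum>i\<in>I. card (?M \<inter> N i))"
    using Mb by (intro sum_subtractf_nat)
  ultimately have eq: "(\<Sum>i\<in>I. b i - card (?M \<inter> N i)) = card S - card Q" using cS by simp
  have "m * (card S - card Q) \<le> m * (J * (136 * 2 ^ J * (\<mu> + 1)))"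
  proof -
    have "card V * (136 * 2 ^ J * (\<mu> + 1)) \<le> J * m * (136 * 2 ^ J * (\<mu> + 1))"
      using J cV by (intro mult_le_mono1) simp
    then show ?thesis using few by (simp only: mult_ac) 
  qed
  moreover have "0 < m" using J by (cases m) auto
  ultimately have "card S - card Q \<le> J * (136 * 2 ^ J * (\<mu> + 1))" by simp
  then show thesis using that[OF MU Md Mb] eq by simp
qed

section \<open>Few and many small demands\<close>

text \<open>Demands from \<open>big h\<close> on satisfy the lower bound in \<open>balanced_matching\<close> with path length \<open>h\<close> and
relative deficit \<open>1 / (2 * h)\<close>. They are padded by a proportion \<open>1 / h\<close>, so that a matching
with such deficits still fulfils the original demand.\<close>
definition big :: "nat \<Rightarrow> nat" where
  "big h = (Suc h)\<^sup>2 * (2 * h)"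

definition padded :: "nat \<Rightarrow> nat \<Rightarrow> nat" where
  "padded h a = a + a div h + 1"

lemma big_ge: "h \<le> big h"
  unfolding big_def by (simp add: power2_eq_square)

lemma padded_surplus:
  assumes h: "0 < h" and x: "2 * h * (padded h a - x) \<le> padded h a"
  shows "a \<le> x"
proof (rule ccontr)
  assume "\<not> a \<le> x"
  then have "a div h + 2 \<le> padded h a - x" by (simp add: padded_def)
  then have "2 * h * (a div h + 2) \<le> padded h a" using x by (meson le_trans mult_le_mono2)
  moreover have "a < h * (a div h + 1)"
    using h by (metis add.commute dividend_less_times_div mult.commute mult_Suc plus_1_eq_Suc)
  moreover have "a div h \<le> a" by simp
  ultimately show False using h unfolding padded_def by (simp add: algebra_simps)
qed

lemma padded_le: "0 < h \<Longrightarrow> h \<le> a \<Longrightarrow> h * padded h a \<le> (h + 2) * a"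
proof -
  assume "0 < h" "h \<le> a"
  moreover have "h * (a div h) \<le> a" by simp
  moreover have "h * padded h a = h * a + h * (a div h) + h" by (simp add: padded_def algebra_simps)
  moreover have "(h + 2) * a = h * a + 2 * a" by (simp add: algebra_simps)
  ultimately show ?thesis by linarith
qed

lemma padded_le_double: "padded h a \<le> 2 * a + 1"
  by (simp add: padded_def)

text \<open>Few small demands are met greedily. Deleting the vertices used there costs every other
matching few edges, so that there is still room for balancing the padded large demands, starting
from the empty matching.\<close>
lemma matching_few_small_demands:
  fixes N :: "nat \<Rightarrow> nat set set" and a :: "nat \<Rightarrow> nat"
  assumes fin: "finite I" and h: "2 \<le> h"
    and N: "\<And>i. i \<in> I \<Longrightarrow> is_perfect_matching (2 * n) (N i)"
    and Ndisj: "disjoint_family_on N I"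
  defines "L \<equiv> {i \<in> I. big h \<le> a i}"
  assumes small: "2 * (\<Sum>i\<in>I - L. a i) \<le> n"
    and room: "(h + 2) * (\<Sum>i\<in>L. padded h (a i)) < (h + 1) * (n - 2 * (\<Sum>i\<in>I - L. a i))"
  obtains M where "M \<subseteq> (\<Union>i\<in>I. N i)" "disjoint M" "\<And>i. i \<in> I \<Longrightarrow> a i \<le> card (M \<inter> N i)"
proof -
  have L: "L \<subseteq> I" by (auto simp: L_def)
  have finL: "finite L" using L fin finite_subset by blast
  have NI: "finite (N i) \<and> disjoint (N i) \<and> (\<forall>e\<in>N i. card e = 2)" "card (N i) = n" if "i \<in> I" for i
    using perfect_matching_facts[OF N[OF that]] by simp_all
  have sub: "disjoint_family_on N (I - L)" using Ndisj by (auto simp: disjoint_family_on_def)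
  obtain S where S: "S \<subseteq> (\<Union>i\<in>I - L. N i)" "disjoint S" "\<And>i. i \<in> I - L \<Longrightarrow> card (S \<inter> N i) = a i"
  proof (rule greedy_matching[of "I - L" N a])
    show "finite (I - L)" using fin by simp
    show "disjoint_family_on N (I - L)" by (rule sub)
    show "finite (N i) \<and> disjoint (N i) \<and> (\<forall>e\<in>N i. card e = 2)" if "i \<in> I - L" for i
      using NI(1) that by blast
    show "2 * (\<Sum>i\<in>I - L. a i) \<le> card (N i)" if "i \<in> I - L" for i
      using NI(2)[of i] that small by simp
  qed (rule that)
  have finS: "finite S" using S(1) fin NI(1) by (intro finite_subset[OF S(1)]) simp
  have S2: "card e = 2" if "e \<in> S" for e using that S(1) NI(1) by blast
  have Sfin: "finite e" if "e \<in> S" for e using S2[OF that] card_ge_0_finite[of e] by simp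
  have cS: "card S = (\<Sum>i\<in>I - L. a i)"
    using card_eq_sum_classes[OF _ finS sub S(1)] fin S(3) by simp
  have "card (\<Union>S) \<le> (\<Sum>e\<in>S. card e)" using Sfin by (intro card_Union_le_sum_card)
  moreover have "(\<Sum>e\<in>S. card e) = 2 * card S" using S2 by simp
  ultimately have cUS: "card (\<Union>S) \<le> 2 * (\<Sum>i\<in>I - L. a i)" using cS by simp
  have finUS: "finite (\<Union>S)" using finS Sfin by blast
  define N' where "N' i = {e \<in> N i. e \<inter> \<Union>S = {}}" for i
  have N': "finite (N' i) \<and> disjoint (N' i) \<and> (\<forall>e\<in>N' i. card e = 2)"
    and cN': "n - 2 * (\<Sum>i\<in>I - L. a i) \<le> card (N' i)" if i: "i \<in> L" for i
  proof -
    have iI: "i \<in> I" using i L by blast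
    have sb: "N' i \<subseteq> N i" by (auto simp: N'_def)
    show "finite (N' i) \<and> disjoint (N' i) \<and> (\<forall>e\<in>N' i. card e = 2)"
      using NI(1)[OF iI] sb finite_subset[OF sb] pairwise_subset[OF _ sb, of disjnt] by (meson subsetD)
    have "card {e \<in> N i. e \<inter> \<Union>S \<noteq> {}} \<le> card (\<Union>S)"
      by (rule card_edges_meeting) (use NI(1)[OF iI] finUS in blast)+
    moreover have "card (N' i) + card {e \<in> N i. e \<inter> \<Union>S \<noteq> {}} = card (N' i \<union> {e \<in> N i. e \<inter> \<Union>S \<noteq> {}})"
      using NI(1)[OF iI] by (intro card_Un_disjoint[symmetric]) (simp_all add: N'_def disjoint_iff)
    moreover have "N' i \<union> {e \<in> N i. e \<inter> \<Union>S \<noteq> {}} = N i" unfolding N'_def by blast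
    then have "card (N' i \<union> {e \<in> N i. e \<inter> \<Union>S \<noteq> {}}) = n" using NI(2)[OF iI] by (simp only:)
    ultimately show "n - 2 * (\<Sum>i\<in>I - L. a i) \<le> card (N' i)" using cUS by linarith
  qed
  obtain M where M: "M \<subseteq> (\<Union>i\<in>L. N' i)" "disjoint M"
    "\<And>i. i \<in> L \<Longrightarrow> 2 * h * (padded h (a i) - card (M \<inter> N' i)) \<le> padded h (a i)"
  proof (rule balanced_matching[of L L "2 * h" N' "{}" "\<lambda>i. padded h (a i)" h])
    show "disjoint_family_on N' L"
      using Ndisj L unfolding disjoint_family_on_def N'_def by blast
    show "2 \<le> 2 * h" using h by simp
    show "(Suc h)\<^sup>2 * (2 * h) \<le> padded h (a i)" if "i \<in> L" for i
      using that by (simp add: L_def big_def padded_def)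
    show "(h + 2) * (\<Sum>i\<in>L. padded h (a i)) < Suc h * card (N' i)" if "i \<in> L" for i
      using room mult_le_mono2[OF cN'[OF that], of "h + 1"] by (simp only: Suc_eq_plus1)
  qed (use N' finL in simp_all)
  have dis: "\<Union>S \<inter> \<Union>M = {}" using M(1) unfolding N'_def by blast
  have finM: "finite M" using finite_subset[OF M(1)] finL N' by simp
  show thesis
  proof (rule that[of "S \<union> M"])
    have "N' i \<subseteq> N i" for i by (simp add: N'_def)
    then have "(\<Union>i\<in>L. N' i) \<subseteq> (\<Union>i\<in>I. N i)" using L by (intro UN_mono)
    moreover have "(\<Union>i\<in>I - L. N i) \<subseteq> (\<Union>i\<in>I. N i)" by (intro UN_mono) auto
    ultimately show "S \<union> M \<subseteq> (\<Union>i\<in>I. N i)"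
      using S(1) M(1) by (metis Un_least order_trans)
    show "disjoint (S \<union> M)" using S(2) M(2) dis by (rule disjoint_Un)
    fix i assume i: "i \<in> I"
    show "a i \<le> card ((S \<union> M) \<inter> N i)"
    proof (cases "i \<in> L")
      case True
      have "a i \<le> card (M \<inter> N' i)" using padded_surplus[OF _ M(3)[OF True]] h by simp
      also have "\<dots> \<le> card ((S \<union> M) \<inter> N i)" using finS finM by (intro card_mono) (auto simp: N'_def)
      finally show ?thesis .
    next
      case False
      then have "a i = card (S \<inter> N i)" using S(3) i by simp
      also have "\<dots> \<le> card ((S \<union> M) \<inter> N i)" using finS finM by (intro card_mono) auto
      finally show ?thesis .
    qed
  qed
qed

text \<open>Many small demands need spare colours, here \<open>k + 1, \<dots>, k + X\<close>, each with a demand that exceeds all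
the small ones. The slot bound gives a matching with few missing edges, and balancing completes the
large demands while leaving at most \<open>X\<close> of the small and spare demands unfulfilled. Hence there are
enough fulfilled spare colours to replace the colours of the unfulfilled small demands.\<close>
lemma matching_with_spare_colours:
  fixes N :: "nat \<Rightarrow> nat set set" and a :: "nat \<Rightarrow> nat" and k X n h m J \<mu> :: nat
  assumes h: "2 \<le> h"
    and N: "\<And>i. i \<in> {1..k + X} \<Longrightarrow> is_perfect_matching (2 * n) (N i)"
    and Ndisj: "disjoint_family_on N {1..k + X}"
  defines "L \<equiv> {i \<in> {1..k}. big h \<le> a i}"
  defines "b \<equiv> \<lambda>i. if i \<in> L then padded h (a i) else if i \<le> k then a i else big h"
  assumes \<mu>: "\<And>i. i \<in> {1..k + X} \<Longrightarrow> b i \<le> \<mu>"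
    and total: "(\<Sum>i\<in>{1..k + X}. b i) + m \<le> n" and J: "2 * n < J * m"
    and room: "(h + 2) * (\<Sum>i\<in>{1..k + X}. b i) < (h + 1) * n"
    and spare: "h * (J * (136 * 2 ^ J * (\<mu> + 1))) \<le> X"
  obtains \<sigma> M where "inj_on \<sigma> {1..k}" "\<sigma> ` {1..k} \<subseteq> {1..k + X}" "M \<subseteq> (\<Union>i\<in>{1..k + X}. N i)" "disjoint M"
    "\<And>i. i \<in> {1..k} \<Longrightarrow> a i \<le> card (M \<inter> N (\<sigma> i))"
proof -
  let ?I = "{1..k + X}"
  have NI: "finite (N i) \<and> disjoint (N i) \<and> (\<forall>e\<in>N i. card e = 2)" "card (N i) = n" if "i \<in> ?I" for i
    using perfect_matching_facts[OF N[OF that]] by simp_all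
  obtain M0 where M0: "M0 \<subseteq> (\<Union>i\<in>?I. N i)" "disjoint M0" "\<And>i. i \<in> ?I \<Longrightarrow> card (M0 \<inter> N i) \<le> b i"
    "(\<Sum>i\<in>?I. b i - card (M0 \<inter> N i)) \<le> J * (136 * 2 ^ J * (\<mu> + 1))"
    by (rule nearly_full_matching[OF _ N Ndisj \<mu> total J]) simp_all
  have L: "L \<subseteq> ?I" by (auto simp: L_def)
  obtain M where M: "M \<subseteq> (\<Union>i\<in>?I. N i)" "disjoint M" 
    "\<And>i. i \<in> L \<Longrightarrow> 2 * h * (b i - card (M \<inter> N i)) \<le> b i"
    "2 * (\<Sum>i\<in>?I - L. b i - card (M \<inter> N i)) \<le> 2 * h * (\<Sum>i\<in>?I. b i - card (M0 \<inter> N i))"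
  proof (rule balanced_matching[of ?I L "2 * h" N M0 b h])
    show "2 \<le> 2 * h" using h by simp
    show "(Suc h)\<^sup>2 * (2 * h) \<le> b i" if "i \<in> L" for i
      using that by (simp add: L_def b_def big_def padded_def)
    show "(h + 2) * (\<Sum>i\<in>?I. b i) < Suc h * card (N i)" if i: "i \<in> L" for i
      using room NI(2) i L by (metis Suc_eq_plus1 subsetD)
    show "finite (N i) \<and> disjoint (N i) \<and> (\<forall>e\<in>N i. card e = 2)" if "i \<in> ?I" for i
      using NI(1) that by blast
  qed (use L Ndisj M0 in simp_all)
  define bad where "bad = {i \<in> ?I - L. card (M \<inter> N i) < b i}"
  have "card bad = (\<Sum>i\<in>bad. 1)" by simp
  also have "\<dots> \<le> (\<Sum>i\<in>bad. b i - card (M \<inter> N i))" by (intro sum_mono) (auto simp: bad_def)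
  also have "\<dots> \<le> (\<Sum>i\<in>?I - L. b i - card (M \<inter> N i))" by (intro sum_mono2) (auto simp: bad_def)
  also have "\<dots> \<le> h * (\<Sum>i\<in>?I. b i - card (M0 \<inter> N i))" using M(4) by simp
  also have "\<dots> \<le> h * (J * (136 * 2 ^ J * (\<mu> + 1)))" using M0(4) by (rule mult_le_mono2)
  also have "\<dots> \<le> X" by (rule spare)
  finally have bad_X: "card bad \<le> X" .
  let ?E = "{k + 1..k + X}"
  let ?B = "bad \<inter> {1..k}"
  have finbad: "finite bad" by (simp add: bad_def)
  have "card ?B \<le> card (?E - bad)"
  proof -
    have "card ?B + card (bad \<inter> ?E) = card (?B \<union> bad \<inter> ?E)"
      using finbad by (intro card_Un_disjoint[symmetric]) auto
    also have "\<dots> \<le> card bad" using finbad by (intro card_mono) auto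
    finally have "card ?B + card (bad \<inter> ?E) \<le> X" using bad_X by simp
    moreover have "card (?E - bad) + card (?E \<inter> bad) = card ?E"
      by (metis card_Diff_subset_Int card_mono finite_Int finite_atLeastAtMost inf_le1 le_add_diff_inverse2)
    moreover have "card ?E = X" by simp
    ultimately show ?thesis by (simp add: Int_commute)
  qed
  then obtain f where f: "f ` ?B \<subseteq> ?E - bad" "inj_on f ?B"
    using card_le_inj[of ?B "?E - bad"] finbad by auto
  define \<sigma> where "\<sigma> i = (if i \<in> bad then f i else i)" for i
  have fE: "f i \<in> ?E" "f i \<notin> bad" if "i \<in> bad" "i \<in> {1..k}" for i
    using f(1) that by blast+
  show thesis
  proof (rule that[of \<sigma> M])
    show "inj_on \<sigma> {1..k}"
    proof (rule inj_onI)
      fix i j assume ij: "i \<in> {1..k}" "j \<in> {1..k}" "\<sigma> i = \<sigma> j"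
      consider "i \<in> bad" "j \<in> bad" | "i \<in> bad" "j \<notin> bad" | "i \<notin> bad" "j \<in> bad" | "i \<notin> bad" "j \<notin> bad"
        by blast
      then show "i = j"
      proof cases
        case 1
        then show ?thesis using ij f(2) by (auto simp: \<sigma>_def dest: inj_onD)
      next
        case 2
        then show ?thesis using ij fE[of i] by (auto simp: \<sigma>_def)
      next
        case 3
        then show ?thesis using ij fE[of j] by (auto simp: \<sigma>_def)
      next
        case 4
        then show ?thesis using ij by (auto simp: \<sigma>_def)
      qed
    qed
    show "\<sigma> ` {1..k} \<subseteq> ?I"
    proof
      fix y assume "y \<in> \<sigma> ` {1..k}"
      then obtain i where i: "i \<in> {1..k}" "y = \<sigma> i" by blast
      show "y \<in> ?I" using i fE[of i] by (cases "i \<in> bad") (auto simp: \<sigma>_def)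
    qed
    show "M \<subseteq> (\<Union>i\<in>?I. N i)" "disjoint M" by fact+
    fix i assume i: "i \<in> {1..k}"
    show "a i \<le> card (M \<inter> N (\<sigma> i))"
    proof (cases "i \<in> L")
      case True
      then have "i \<notin> bad" by (auto simp: bad_def)
      moreover have "b i = padded h (a i)" using True by (simp add: b_def)
      then have "a i \<le> card (M \<inter> N i)" using padded_surplus[of h "a i"] M(3)[OF True] h by simp
      ultimately show ?thesis by (simp add: \<sigma>_def)
    next
      case False
      then have ai: "a i < big h" "b i = a i" using i by (auto simp: L_def b_def)
      show ?thesis
      proof (cases "i \<in> bad")
        case True
        have fi: "f i \<in> ?E" "f i \<notin> bad" using fE[OF True i] by auto
        then have "f i \<notin> L" "f i \<in> ?I" "b (f i) = big h" by (auto simp: L_def b_def)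
        then have "big h \<le> card (M \<inter> N (f i))" using fi(2) by (auto simp: bad_def)
        then show ?thesis using ai True by (simp add: \<sigma>_def)
      next
        case False
        then show ?thesis using ai i \<open>i \<notin> L\<close> by (auto simp: bad_def \<sigma>_def)
      qed
    qed
  qed
qed

section \<open>Happy sequences\<close>

lemma sum_padded_le:
  assumes h: "8 \<le> \<epsilon> * real h" and \<epsilon>: "0 < \<epsilon>"
    and L: "\<And>i. i \<in> L \<Longrightarrow> h \<le> a i" and total: "real (\<Sum>i\<in>L. a i) \<le> real n"
  shows "real (\<Sum>i\<in>L. padded h (a i)) \<le> real (\<Sum>i\<in>L. a i) + \<epsilon> / 4 * real n"
proof -
  have h0: "0 < real h" using h \<epsilon> by (smt (verit, best) mult_nonneg_nonpos)
  have "h * (\<Sum>i\<in>L. padded h (a i)) \<le> (h + 2) * (\<Sum>i\<in>L. a i)"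
    unfolding sum_distrib_left using h0 L by (intro sum_mono padded_le) simp_all
  then have "real h * real (\<Sum>i\<in>L. padded h (a i)) \<le> (real h + 2) * real (\<Sum>i\<in>L. a i)"
    by (metis (mono_tags, lifting) of_nat_add of_nat_le_iff of_nat_mult of_nat_numeral)
  also have "\<dots> \<le> real h * real (\<Sum>i\<in>L. a i) + 2 * real n" using total by (simp add: algebra_simps)
  also have "2 * real n \<le> real h * (\<epsilon> / 4 * real n)"
    using mult_right_mono[OF h, of "real n"] by (simp add: algebra_simps)
  finally have "real h * real (\<Sum>i\<in>L. padded h (a i)) \<le> real h * (real (\<Sum>i\<in>L. a i) + \<epsilon> / 4 * real n)"
    by (simp add: algebra_simps)
  then show ?thesis using h0 by simp
qed

lemma room_inequality:
  fixes \<epsilon> h x :: real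
  assumes "8 \<le> \<epsilon> * h" "0 < \<epsilon>" "0 < x"
  shows "(h + 2) * ((1 - \<epsilon> / 2) * x) < (h + 1) * ((1 - \<epsilon> / 4) * x)"
proof -
  have "(h + 1) * (1 - \<epsilon> / 4) - (h + 2) * (1 - \<epsilon> / 2) = \<epsilon> * h / 4 + 3 * \<epsilon> / 4 - 1"
    by (simp add: field_simps)
  then have "(h + 2) * (1 - \<epsilon> / 2) < (h + 1) * (1 - \<epsilon> / 4)" using assms by linarith
  from mult_strict_right_mono[OF this assms(3)] show ?thesis by (simp only: mult.assoc)
qed

text \<open>It is enough to find the matching for an enumerated family of \<open>k + X\<close> perfect matchings, where
\<open>\<sigma>\<close> selects and labels \<open>k\<close> of them.\<close>
lemma happyI:
  assumes X: "real X \<le> \<epsilon> * real k"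
    and ex: "\<And>N. (\<And>i. i \<in> {1..k + X} \<Longrightarrow> is_perfect_matching (2 * n) (N i)) \<Longrightarrow>
      disjoint_family_on N {1..k + X} \<Longrightarrow>
      \<exists>\<sigma> M. inj_on \<sigma> {1..k} \<and> \<sigma> ` {1..k} \<subseteq> {1..k + X} \<and> M \<subseteq> (\<Union>i\<in>{1..k + X}. N i) \<and>
        disjoint M \<and> (\<forall>i\<in>{1..k}. a i \<le> int (card (M \<inter> N (\<sigma> i))))"
  shows "happy \<epsilon> n k a"
  unfolding happy_def
proof (intro exI[of _ "k + X"] conjI allI impI)
  show "real (k + X) \<le> (1 + \<epsilon>) * real k" using X by (simp add: algebra_simps)
  fix P :: "nat set set set"
  assume P: "finite P \<and> card P = k + X \<and> (\<forall>N\<in>P. is_perfect_matching (2 * n) N) \<and> disjoint P"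
  then obtain g where g: "bij_betw g {1..k + X} P" using ex_bij_betw_nat_finite_1[of P] by auto
  have gP: "g i \<in> P" if "i \<in> {1..k + X}" for i using g that by (auto simp: bij_betw_def)
  have N: "is_perfect_matching (2 * n) (g i)" if "i \<in> {1..k + X}" for i using gP[OF that] P by blast
  have "disjoint_family_on g {1..k + X}"
  proof (unfold disjoint_family_on_def, intro ballI impI)
    fix i j assume ij: "i \<in> {1..k + X}" "j \<in> {1..k + X}" "i \<noteq> j"
    then have "g i \<noteq> g j" using g by (auto simp: bij_betw_def dest: inj_onD)
    then show "g i \<inter> g j = {}" using P gP[OF ij(1)] gP[OF ij(2)] by (auto simp: pairwise_def disjnt_def)
  qed
  with N have "\<exists>\<sigma> M. inj_on \<sigma> {1..k} \<and> \<sigma> ` {1..k} \<subseteq> {1..k + X} \<and> M \<subseteq> (\<Union>i\<in>{1..k + X}. g i) \<and>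
      disjoint M \<and> (\<forall>i\<in>{1..k}. a i \<le> int (card (M \<inter> g (\<sigma> i))))"
    by (rule ex)
  then obtain \<sigma> M where M: "inj_on \<sigma> {1..k}" "\<sigma> ` {1..k} \<subseteq> {1..k + X}"
    "M \<subseteq> (\<Union>i\<in>{1..k + X}. g i)" "disjoint M" "\<forall>i\<in>{1..k}. a i \<le> int (card (M \<inter> g (\<sigma> i)))"
    by (elim exE conjE) (rule that)
  have "M \<subseteq> complete_edges (2 * n)" using M(3) perfect_matching_facts(5)[OF N] by blast
  then have "is_matching (2 * n) M" using M(4) by (simp add: is_matching_def)
  moreover have "inj_on (g \<circ> \<sigma>) {1..k}"
    using M(1,2) g by (intro comp_inj_on) (auto simp: bij_betw_def intro: inj_on_subset)
  moreover have "(g \<circ> \<sigma>) ` {1..k} \<subseteq> P" using M(2) gP by auto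
  moreover have "\<forall>i\<in>{1..k}. a i \<le> int (card (M \<inter> (g \<circ> \<sigma>) i))" using M(5) by simp
  ultimately show "\<exists>L M. inj_on L {1..k} \<and> L ` {1..k} \<subseteq> P \<and> is_matching (2 * n) M \<and>
    (\<forall>i\<in>{1..k}. int (card (M \<inter> L i)) \<ge> a i)"
    by blast
qed simp

theorem theorem1p3:
  fixes \<epsilon> :: real
  assumes "0 < \<epsilon>" and "\<epsilon> < 1"
  shows "\<exists>n0::nat. \<forall>n\<ge>n0. \<forall>(k::nat) (a :: nat \<Rightarrow> int).
    (\<forall>i\<in>{1..k}. a i > 0) \<longrightarrow>
    real_of_int (\<Sum>i=1..k. a i) < (1 - \<epsilon>) * real n \<longrightarrow>
    (\<forall>i\<in>{1..k}. real_of_int (a i) \<le> real n powr (1 - \<epsilon>)) \<or>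
    (\<forall>i\<in>{1..k}. real_of_int (a i) \<ge> real n powr \<epsilon>) \<longrightarrow>
    happy \<epsilon> n k a"
proof -
  \<comment> \<open>\<open>h\<close> is the length of the augmentations, and \<open>1 / h\<close> the padding proportion;
    \<open>J\<close> is the number of levels; \<open>Z\<close> is the value from which on \<open>n powr \<epsilon>\<close> makes the
    number \<open>X \<le> D * n powr (1 - \<epsilon>)\<close> of spare colours small compared with \<open>n\<close>, and exceeds the bound \<open>C\<close> on small demands.\<close>
  define h :: nat where "h = nat \<lceil>8 / \<epsilon>\<rceil>"
  define C J K :: nat where "C = big h" and "J = 2 * h" and "K = h * (J * (136 * 2 ^ J))"
  define D where "D = real K * (real C + 4)"
  define Z where "Z = 8 * real C * D / \<epsilon>\<^sup>2 + real C"
  define n0 where "n0 = nat \<lceil>Z powr (1 / \<epsilon>)\<rceil> + h + 1"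
  have "8 / \<epsilon> \<le> real h" unfolding h_def by linarith
  then have h8: "8 \<le> \<epsilon> * real h" using assms by (simp add: field_simps)
  have h_ge: "8 \<le> h"
  proof -
    have "\<epsilon> * real h \<le> 1 * real h" using assms by (intro mult_right_mono) auto
    then show ?thesis using h8 by linarith
  qed
  have C1: "0 < C" using h_ge big_ge[of h] by (simp add: C_def)
  have D0: "0 \<le> D" by (simp add: D_def)
  have Z0: "0 \<le> Z" using D0 by (simp add: Z_def)
  show ?thesis
  proof (rule exI[of _ n0], intro allI impI)
    fix n k :: nat and a :: "nat \<Rightarrow> int"
    assume n: "n0 \<le> n" and pos: "\<forall>i\<in>{1..k}. 0 < a i"
      and sum_a: "real_of_int (\<Sum>i=1..k. a i) < (1 - \<epsilon>) * real n"
      and cases: "(\<forall>i\<in>{1..k}. real_of_int (a i) \<le> real n powr (1 - \<epsilon>)) \<or>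
        (\<forall>i\<in>{1..k}. real n powr \<epsilon> \<le> real_of_int (a i))"
    have n_h: "real h \<le> real n" and n1: "1 \<le> real n" and nZ: "Z powr (1 / \<epsilon>) \<le> real n"
      using n unfolding n0_def by linarith+
    have "(Z powr (1 / \<epsilon>)) powr \<epsilon> \<le> real n powr \<epsilon>" using nZ assms by (intro powr_mono2) auto
    then have n\<epsilon>: "Z \<le> real n powr \<epsilon>" using Z0 assms by (simp add: powr_powr)
    have n8: "8 \<le> \<epsilon> * real n"
      using h8 mult_left_mono[OF n_h, of \<epsilon>] assms by linarith
    define d where "d i = nat (a i)" for i
    have ad: "a i = int (d i)" if "i \<in> {1..k}" for i using pos that by (simp add: d_def order_less_imp_le)
    have "(\<Sum>i=1..k. a i) = int (\<Sum>i=1..k. d i)" using ad by simp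
    then have sum_d: "real (\<Sum>i=1..k. d i) < (1 - \<epsilon>) * real n" using sum_a by simp
    define L where "L = {i \<in> {1..k}. big h \<le> d i}"
    define s where "s = (\<Sum>i\<in>{1..k} - L. d i)"
    have L: "L \<subseteq> {1..k}" by (auto simp: L_def)
    have split: "(\<Sum>i=1..k. d i) = (\<Sum>i\<in>L. d i) + s"
      unfolding s_def using L by (metis add.commute finite_atLeastAtMost sum.subset_diff)
    have \<epsilon>n: "(1 - \<epsilon>) * real n \<le> real n" using assms by (simp add: algebra_simps)
    have sum_L: "real (\<Sum>i\<in>L. d i) + real s < (1 - \<epsilon>) * real n"
      using sum_d by (simp only: split of_nat_add)
    then have "real (\<Sum>i\<in>L. d i) \<le> real n" using \<epsilon>n by linarith
    then have pad: "real (\<Sum>i\<in>L. padded h (d i)) \<le> real (\<Sum>i\<in>L. d i) + \<epsilon> / 4 * real n"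
      using big_ge[of h] by (intro sum_padded_le[OF h8 assms(1)]) (auto simp: L_def)
    show "happy \<epsilon> n k a"
    proof (cases "real (2 * s) \<le> \<epsilon> / 4 * real n")
      case True
      have "real (\<Sum>i\<in>L. padded h (d i)) \<le> (1 - \<epsilon> / 2) * real n"
        using pad sum_L n8 by (simp add: algebra_simps del: of_nat_sum)
      then have "(real h + 2) * real (\<Sum>i\<in>L. padded h (d i)) \<le> (real h + 2) * ((1 - \<epsilon> / 2) * real n)"
        by (intro mult_left_mono) auto
      also have "\<dots> < (real h + 1) * ((1 - \<epsilon> / 4) * real n)"
        using n1 by (intro room_inequality h8 assms) simp
      also have "\<dots> \<le> (real h + 1) * (real n - real (2 * s))"
        using True by (intro mult_left_mono) (simp_all add: algebra_simps)
      finally have *: "(real h + 2) * real (\<Sum>i\<in>L. padded h (d i)) < (real h + 1) * (real n - real (2 * s))" .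
      have "\<epsilon> / 4 * real n \<le> 1 * real n" using assms by (intro mult_right_mono) auto
      then have s_n: "2 * s \<le> n" using True by linarith
      have "real ((h + 2) * (\<Sum>i\<in>L. padded h (d i))) < real ((h + 1) * (n - 2 * s))"
        using * by (simp only: of_nat_mult of_nat_add of_nat_numeral of_nat_1 of_nat_diff[OF s_n])
      then have room: "(h + 2) * (\<Sum>i\<in>L. padded h (d i)) < (h + 1) * (n - 2 * s)" by (simp only: of_nat_less_iff)
      show ?thesis
      proof (rule happyI[of 0])
        fix N assume N: "\<And>i. i \<in> {1..k + 0} \<Longrightarrow> is_perfect_matching (2 * n) (N i)"
          and Ndisj: "disjoint_family_on N {1..k + 0}"
        obtain M where M: "M \<subseteq> (\<Union>i\<in>{1..k}. N i)" "disjoint M"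
          "\<And>i. i \<in> {1..k} \<Longrightarrow> d i \<le> card (M \<inter> N i)"
          by (rule matching_few_small_demands[of "{1..k}" h n N d])
            (use h_ge N Ndisj s_n room in \<open>simp_all add: L_def s_def\<close>)
        have "\<forall>i\<in>{1..k}. a i \<le> int (card (M \<inter> N (id i)))" using M(3) ad by simp
        then show "\<exists>\<sigma> M. inj_on \<sigma> {1..k} \<and> \<sigma> ` {1..k} \<subseteq> {1..k + 0} \<and> M \<subseteq> (\<Union>i\<in>{1..k + 0}. N i) \<and>
          disjoint M \<and> (\<forall>i\<in>{1..k}. a i \<le> int (card (M \<inter> N (\<sigma> i))))"
          using M(1,2) by (intro exI[of _ id] exI[of _ M]) simp
      qed (use assms in simp)
    next
      case False
      \<comment> \<open>In the second alternative of the hypothesis there would be no small demands at all.\<close>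
      have not_ii: "\<not> (\<forall>i\<in>{1..k}. real n powr \<epsilon> \<le> real_of_int (a i))"
      proof
        assume ii: "\<forall>i\<in>{1..k}. real n powr \<epsilon> \<le> real_of_int (a i)"
        have "big h \<le> d i" if "i \<in> {1..k}" for i
        proof -
          have "real C \<le> Z" using D0 by (simp add: Z_def)
          then have "real C \<le> real (d i)" using ii that n\<epsilon> ad[OF that] by fastforce
          then show ?thesis by (simp add: C_def)
        qed
        then have "{1..k} - L = {}" by (auto simp: L_def)
        then have "s = 0" unfolding s_def by (simp only: sum.empty)
        then show False using False assms by simp
      qed
      define r where "r = real n powr (1 - \<epsilon>)"
      have d_r: "real (d i) \<le> r" if "i \<in> {1..k}" for i
      proof -
        have "real_of_int (a i) \<le> r" using cases not_ii that unfolding r_def by blast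
        then show ?thesis by (simp add: ad[OF that])
      qed
      have r1: "1 \<le> r" unfolding r_def using n1 assms by (intro ge_one_powr_ge_zero) auto
      define \<mu> where "\<mu> = nat \<lfloor>2 * r\<rfloor> + 1 + C"
      define X where "X = h * (J * (136 * 2 ^ J * (\<mu> + 1)))"
      define m where "m = nat \<lfloor>\<epsilon> / 4 * real n\<rfloor>"
      define b where "b i = (if i \<in> L then padded h (d i) else if i \<le> k then d i else big h)" for i
      have X_r: "real X \<le> D * r"
      proof -
        have "real \<mu> + 1 \<le> 2 * r + real C + 2" unfolding \<mu>_def using r1 by simp
        also have "\<dots> \<le> (real C + 4) * r"
          using r1 mult_left_mono[OF r1, of "real C"] by (simp add: algebra_simps)
        finally have "real K * (real \<mu> + 1) \<le> real K * ((real C + 4) * r)" by (intro mult_left_mono) auto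
        moreover have "X = K * (\<mu> + 1)" by (simp only: X_def K_def mult.assoc)
        then have "real X = real K * (real \<mu> + 1)" by (simp only: of_nat_mult of_nat_add of_nat_1)
        ultimately show ?thesis by (simp only: D_def mult.assoc)
      qed
      have X_n: "8 * real C * real X \<le> \<epsilon>\<^sup>2 * real n"
      proof -
        have "8 * real C * D / \<epsilon>\<^sup>2 \<le> real n powr \<epsilon>" using n\<epsilon> by (simp add: Z_def)
        then have "8 * real C * D \<le> \<epsilon>\<^sup>2 * real n powr \<epsilon>" using assms by (simp add: field_simps)
        then have "8 * real C * D * r \<le> \<epsilon>\<^sup>2 * real n powr \<epsilon> * r" using r1 by (intro mult_right_mono) auto
        moreover have "real n powr \<epsilon> * r = real n" using n1 by (simp add: r_def flip: powr_add)
        ultimately have "8 * real C * (D * r) \<le> \<epsilon>\<^sup>2 * real n" by (simp only: mult.assoc)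
        moreover have "8 * real C * real X \<le> 8 * real C * (D * r)" using X_r by (intro mult_left_mono) auto
        ultimately show ?thesis by linarith
      qed
      \<comment> \<open>Small demands of total size proportional to \<open>n\<close> force \<open>k\<close> to be proportional to \<open>n\<close>, so
        that the proportion \<open>\<epsilon>\<close> of spare colours is enough.\<close>
      have X_k: "real X \<le> \<epsilon> * real k"
      proof -
        have "s \<le> (\<Sum>i\<in>{1..k} - L. C)" unfolding s_def by (intro sum_mono) (auto simp: L_def C_def)
        also have "\<dots> \<le> k * C" using card_mono[of "{1..k}" "{1..k} - L"] by simp
        finally have "real s \<le> real k * real C" by (metis of_nat_le_iff of_nat_mult)
        then have "\<epsilon> * real n \<le> 8 * (real k * real C)" using False by simp
        then have "\<epsilon> * (\<epsilon> * real n) \<le> \<epsilon> * (8 * (real k * real C))" using assms by (intro mult_left_mono) auto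
        then have "8 * real C * real X \<le> 8 * real C * (\<epsilon> * real k)"
          using X_n by (simp add: power2_eq_square mult_ac)
        then show ?thesis using C1 by simp
      qed
      have CX: "real (C * X) \<le> \<epsilon> / 8 * real n"
      proof -
        have "\<epsilon>\<^sup>2 * real n \<le> \<epsilon> * real n" using assms by (intro mult_right_mono) (simp_all add: power2_eq_square)
        then show ?thesis using X_n by simp
      qed
      have "(\<Sum>i\<in>{1..k + X}. b i) = (\<Sum>i\<in>{1..k}. b i) + (\<Sum>i\<in>{k + 1..k + X}. b i)"
        by (rule sum.ub_add_nat) simp
      also have "(\<Sum>i\<in>{k + 1..k + X}. b i) = (\<Sum>i\<in>{k + 1..k + X}. C)"
        using L by (intro sum.cong) (auto simp: b_def C_def)
      also have "(\<Sum>i\<in>{1..k}. b i) = (\<Sum>i\<in>{1..k} - L. b i) + (\<Sum>i\<in>L. b i)"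
        using L by (intro sum.subset_diff) auto
      also have "(\<Sum>i\<in>L. b i) = (\<Sum>i\<in>L. padded h (d i))" by (intro sum.cong) (auto simp: b_def)
      also have "(\<Sum>i\<in>{1..k} - L. b i) = s" unfolding s_def by (intro sum.cong) (auto simp: b_def)
      finally have "real (\<Sum>i\<in>{1..k + X}. b i) = real s + real (\<Sum>i\<in>L. padded h (d i)) + real (C * X)"
        by simp
      also have "\<dots> \<le> (1 - \<epsilon> / 2) * real n"
        using pad sum_L CX n8
        by (simp add: algebra_simps del: of_nat_sum)
      finally have total: "real (\<Sum>i\<in>{1..k + X}. b i) \<le> (1 - \<epsilon> / 2) * real n" .
      have m: "real m \<le> \<epsilon> / 4 * real n" "\<epsilon> / 4 * real n - 1 < real m"
        using n8 unfolding m_def by linarith+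
      have total_m: "(\<Sum>i\<in>{1..k + X}. b i) + m \<le> n"
      proof -
        have "real ((\<Sum>i\<in>{1..k + X}. b i) + m) \<le> real n" using total m n8 by (simp add: algebra_simps)
        then show ?thesis by (simp only: of_nat_le_iff)
      qed
      have Jm: "2 * n < J * m"
      proof -
        have "8 * real n \<le> \<epsilon> * real h * real n" using h8 by (intro mult_right_mono) auto
        also have "\<dots> = 4 * (real h * (\<epsilon> / 4 * real n))" by simp
        also have "real h * (\<epsilon> / 4 * real n) \<le> real h * (2 * (\<epsilon> / 4 * real n - 1))"
          using n8 by (intro mult_left_mono) auto
        also have "\<dots> < real h * (2 * real m)" using m h_ge by (intro mult_strict_left_mono) auto
        finally have "real (2 * n) < real (J * m)" by (simp add: J_def)
        then show ?thesis by (simp only: of_nat_less_iff)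
      qed
      have room: "(h + 2) * (\<Sum>i\<in>{1..k + X}. b i) < (h + 1) * n"
      proof -
        have "(real h + 2) * real (\<Sum>i\<in>{1..k + X}. b i) \<le> (real h + 2) * ((1 - \<epsilon> / 2) * real n)"
          using total by (intro mult_left_mono) auto
        also have "\<dots> < (real h + 1) * ((1 - \<epsilon> / 4) * real n)"
          using n1 by (intro room_inequality h8 assms) simp
        also have "\<dots> \<le> (real h + 1) * real n"
          using assms n1 by (intro mult_left_mono) (auto simp: algebra_simps)
        finally have "real ((h + 2) * (\<Sum>i\<in>{1..k + X}. b i)) < real ((h + 1) * n)"
          by (simp only: of_nat_mult of_nat_add of_nat_numeral of_nat_1)
        then show ?thesis by (simp only: of_nat_less_iff)
      qed
      have b_\<mu>: "b i \<le> \<mu>" if "i \<in> {1..k + X}" for i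
      proof (cases "i \<in> L")
        case True
        then have "2 * real (d i) \<le> 2 * r" using d_r L by auto
        then have "2 * d i \<le> nat \<lfloor>2 * r\<rfloor>" by linarith
        then show ?thesis using True padded_le_double[of h "d i"] by (simp add: b_def \<mu>_def)
      next
        case False
        then show ?thesis using that by (auto simp: b_def \<mu>_def C_def L_def)
      qed
      show ?thesis
      proof (rule happyI[OF X_k])
        fix N assume N: "\<And>i. i \<in> {1..k + X} \<Longrightarrow> is_perfect_matching (2 * n) (N i)"
          and Ndisj: "disjoint_family_on N {1..k + X}"
        obtain \<sigma> M where M: "inj_on \<sigma> {1..k}" "\<sigma> ` {1..k} \<subseteq> {1..k + X}" "M \<subseteq> (\<Union>i\<in>{1..k + X}. N i)"
          "disjoint M" "\<And>i. i \<in> {1..k} \<Longrightarrow> d i \<le> card (M \<inter> N (\<sigma> i))"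
          by (rule matching_with_spare_colours[of h k X n N d \<mu> m J, folded L_def, folded b_def])
            (use h_ge N Ndisj b_\<mu> total_m Jm room in \<open>simp_all add: X_def\<close>)
        have "\<forall>i\<in>{1..k}. a i \<le> int (card (M \<inter> N (\<sigma> i)))" using M(5) ad by simp
        then show "\<exists>\<sigma> M. inj_on \<sigma> {1..k} \<and> \<sigma> ` {1..k} \<subseteq> {1..k + X} \<and> M \<subseteq> (\<Union>i\<in>{1..k + X}. N i) \<and>
          disjoint M \<and> (\<forall>i\<in>{1..k}. a i \<le> int (card (M \<inter> N (\<sigma> i))))"
          using M(1-4) by blast
      qed
    qed
  qed
qed

end
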